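(* Suppose $F\in P_{3,6}$ and $|\mathcal Z(F)|=10$. Then $F\in E(P_{3,6})$.
   Context: $P_{3,6}$ is the closed convex cone of real ternary sextic forms $F(x,y,z)$ that are psd, i.e. $F(a)\ge0$ for all $a\in\mathbb R^3$. $\mathcal Z(F)$ is the set of nonzero real zeros of $F$, and $|\mathcal Z(F)|$ denotes the number of lines through the origin in $\mathcal Z(F)$ (i.e. real projective zeros). $E(P_{3,6})$ is the set of extremal forms: $F\in P_{3,6}$ is extremal if $F=G_1+G_2$ with $G_1,G_2\in P_{3,6}$ implies $G_j=\lambda_jF$ for some real $\lambda_j\ge0$, $j=1,2$. *)

theory Defs
  imports "HOL-Analysis.Analysis"
begin

text \<open>A real ternary form of degree \<open>d\<close> is identified with the function it induces on
  \<open>real ^ 3\<close>; as the reals are infinite, this determines its coefficients.\<close>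

definition ternary_forms :: "nat \<Rightarrow> (real ^ 3 \<Rightarrow> real) set" where
  "ternary_forms d =
     {F. \<exists>c :: nat \<Rightarrow> nat \<Rightarrow> nat \<Rightarrow> real. \<forall>a.
        F a = (\<Sum>(i, j, k) \<in> {(i, j, k). i + j + k = d}.
                 c i j k * (a $ 1) ^ i * (a $ 2) ^ j * (a $ 3) ^ k)}"

text \<open>The sum above would silently vanish if its index set were infinite; it is not.\<close>

lemma finite_ternary_exponents: "finite {(i, j, k). i + j + k = (d :: nat)}"
  by (rule finite_subset[of _ "{..d} \<times> {..d} \<times> {..d}"]) auto

definition P36 :: "(real ^ 3 \<Rightarrow> real) set" where
  "P36 = {F \<in> ternary_forms 6. \<forall>a. 0 \<le> F a}"

definition zeros :: "(real ^ 3 \<Rightarrow> real) \<Rightarrow> (real ^ 3) set" where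
  "zeros F = {a. a \<noteq> 0 \<and> F a = 0}"

definition zero_lines :: "(real ^ 3 \<Rightarrow> real) \<Rightarrow> (real ^ 3) set set" where
  "zero_lines F = {span {a} | a. a \<in> zeros F}"

definition extremal_P36 :: "(real ^ 3 \<Rightarrow> real) set" where
  "extremal_P36 =
     {F \<in> P36. \<forall>G1 \<in> P36. \<forall>G2 \<in> P36. (\<forall>a. F a = G1 a + G2 a) \<longrightarrow>
        (\<exists>l1 \<ge> 0. \<forall>a. G1 a = l1 * F a) \<and> (\<exists>l2 \<ge> 0. \<forall>a. G2 a = l2 * F a)}"

end

theory Submission
  imports
    Defs
    "HOL-Computational_Algebra.Polynomial_Factorial"
    "HOL-Computational_Algebra.Field_as_Ring"
begin

text \<open>If \<open>F = G + G'\<close> with psd summands, then \<open>F\<close> and \<open>G\<close> are both singular at the ten zeros of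
  \<open>F\<close>, so they meet there with multiplicity at least \<open>40 > 36\<close>, and by Bezout they have a common
  factor \<open>h\<close>. If \<open>h\<close> has degree 6, then \<open>G\<close> is a multiple of \<open>F\<close>. Otherwise \<open>F\<close> is a product of two
  forms of lower degree with finitely many zeros. Such forms are semidefinite, hence of
  even degree; but a semidefinite quadratic form with finitely many zeros has at most one zero, and a
  semidefinite quartic form at most four, which leaves at most five zeros for \<open>F\<close>.

  The computations take place in an affine chart in which the ten zeros are finite and have distinct
  abscissae and in which \<open>F\<close> does not vanish at the point at infinity of the \<open>y\<close>-axis.\<close>

section \<open>Nonnegative univariate polynomials\<close>

text \<open>No theory of local intersection multiplicities is used; a dimension count takes its
  place. For coprime \<open>f\<close> and \<open>g\<close> of degree \<open>d\<close>, their
  multiples in a large degree leave at most \<open>d * d\<close> dimensions, while each common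
  double point cuts out four: the value, two first derivatives and one functional on quadratic
  parts. Nine points would give 36 on both sides, so ten is the threshold of the argument. The chart
  is shaped by this count. Distinct abscissae allow the conditions at different points to be
  separated by products of cubes of linear polynomials in x. Nonvanishing at infinity makes the
  y-degree of \<open>f\<close> equal to its total degree, so that divisibility and the degrees of
  factors can be read off in y alone. The bounds for conics and quartics come from curves through
  too many zeros: a line through two zeros would carry four roots in degree 2, and a conic through
  five zeros ten roots in degree 8. Finiteness of the zero set yields semidefiniteness because the
  plane minus a finite set is connected.\<close>

lemma poly_nonneg_cofinite:
  fixes p :: "real poly"
  assumes "finite S" and "\<And>x. x \<notin> S \<Longrightarrow> 0 \<le> poly p x"
  shows "0 \<le> poly p x"
proof (rule ccontr)
  assume "\<not> 0 \<le> poly p x"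
  have "open {x. poly p x < 0}"
    by (intro open_Collect_less continuous_intros)
  moreover have "{x. poly p x < 0} \<noteq> {}"
    using \<open>\<not> 0 \<le> poly p x\<close> by (auto simp: not_le)
  ultimately have "infinite {x. poly p x < 0}"
    using finite_imp_not_open by blast
  moreover have "{x. poly p x < 0} \<subseteq> S"
    using assms(2) by force
  ultimately show False
    using assms(1) finite_subset by blast
qed

text \<open>The cofactor of one linear factor is nonnegative to the right of \<open>t\<close> and
  nonpositive to the left, so by continuity it vanishes at \<open>t\<close> too. Nonnegativity of
  \<open>q\<close> is returned so that the extraction can be repeated at further roots.\<close>

lemma nonneg_poly_double_root:
  fixes p :: "real poly"
  assumes nonneg: "\<And>x. 0 \<le> poly p x" and root: "poly p t = 0"
  obtains q where "p = [:-t, 1:] ^ 2 * q" and "\<And>x. 0 \<le> poly q x"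
proof -
  obtain r where r: "p = [:-t, 1:] * r"
    using root by (metis dvdE poly_eq_0_iff_dvd)
  have r1: "0 \<le> poly r x" if "x > t" for x
    using nonneg[of x] that by (simp add: r zero_le_mult_iff flip: left_diff_distrib)
  have r2: "poly r x \<le> 0" if "x < t" for x
    using nonneg[of x] that by (simp add: r zero_le_mult_iff flip: left_diff_distrib)
  have cont: "(poly r \<longlongrightarrow> poly r t) (at t)"
    using isCont_def poly_isCont by blast
  have "0 \<le> poly r t"
  proof (rule tendsto_lowerbound)
    show "(poly r \<longlongrightarrow> poly r t) (at_right t)"
      using cont filterlim_at_split by blast
    show "eventually (\<lambda>x. 0 \<le> poly r x) (at_right t)"
      using eventually_at_right_less r1 by (rule eventually_mono)
  qed auto
  moreover have "poly r t \<le> 0"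
  proof (rule tendsto_upperbound)
    show "(poly r \<longlongrightarrow> poly r t) (at_left t)"
      using cont filterlim_at_split by blast
    show "eventually (\<lambda>x. poly r x \<le> 0) (at_left t)"
      using r2 by (auto simp: eventually_at_filter)
  qed auto
  ultimately have "poly r t = 0" by simp
  then obtain q where q: "r = [:-t, 1:] * q"
    by (metis dvdE poly_eq_0_iff_dvd)
  have p: "p = [:-t, 1:] ^ 2 * q"
    by (simp only: r q power2_eq_square mult.assoc)
  have "0 \<le> poly q x" if "x \<notin> {t}" for x
  proof -
    have "0 \<le> (x - t)\<^sup>2 * poly q x"
      using nonneg[of x] by (simp add: p power2_eq_square algebra_simps)
    then show ?thesis
      using that by (simp add: zero_le_mult_iff)
  qed
  then have "0 \<le> poly q x" for x
    by (rule poly_nonneg_cofinite[rotated]) auto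
  with p show ?thesis by (rule that)
qed

lemma nonneg_poly_card_roots:
  fixes p :: "real poly"
  assumes "finite T" and "\<And>x. 0 \<le> poly p x" and "\<And>t. t \<in> T \<Longrightarrow> poly p t = 0" and "p \<noteq> 0"
  shows "2 * card T \<le> degree p"
  using assms
proof (induction T arbitrary: p)
  case empty
  then show ?case by simp
next
  case (insert t T)
  obtain q where q: "p = [:-t, 1:] ^ 2 * q" and nonneg: "\<And>x. 0 \<le> poly q x"
    using nonneg_poly_double_root[of p t] insert.prems by blast
  have "q \<noteq> 0" using insert.prems q by auto
  have "2 * card T \<le> degree q"
  proof (rule insert.IH)
    show "poly q s = 0" if "s \<in> T" for s
      using insert.prems(2)[of s] that insert.hyps(2) by (auto simp: q)
  qed (use nonneg \<open>q \<noteq> 0\<close> in auto)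
  moreover have "degree p = 2 + degree q"
    using \<open>q \<noteq> 0\<close> by (simp add: q degree_mult_eq degree_power_eq del: power2_eq_square)
  ultimately show ?case
    using insert.hyps by simp
qed

lemma odd_degree_poly_changes_sign:
  fixes p :: "real poly"
  assumes "odd (degree p)"
  obtains x y where "poly p x < 0" and "0 < poly p y"
proof -
  have *: "\<exists>x y. poly p x < 0 \<and> 0 < poly p y" if odd: "odd (degree p)" and pos: "lead_coeff p > 0" for p :: "real poly"
  proof -
    obtain y where y: "poly p y \<ge> lead_coeff p"
      using poly_pinfty_gt_lc[OF pos] by blast
    \<comment> \<open>In odd degree -p(-x) has the same leading coefficient as p, so its growth at
      plus infinity shows that p is negative near minus infinity.\<close>
    define q where "q = - pcompose p [:0, -1:]"
    have "lead_coeff q = lead_coeff p"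
      using odd by (simp add: q_def lead_coeff_comp lead_coeff_minus del: degree_pcompose)
    then obtain x where "poly q x \<ge> lead_coeff p"
      using poly_pinfty_gt_lc[of q] pos by fastforce
    then have "poly p (-x) < 0"
      using pos by (simp add: q_def poly_pcompose)
    then show ?thesis using y pos by (metis less_le_trans)
  qed
  have "lead_coeff p \<noteq> 0" using assms by auto
  then consider "lead_coeff p > 0" | "lead_coeff (-p) > 0"
    by (fastforce simp: lead_coeff_minus)
  then have "\<exists>x y. poly p x < 0 \<and> 0 < poly p y"
  proof cases
    case 1
    then show ?thesis using * assms by blast
  next
    case 2
    then show ?thesis using *[of "-p"] assms by auto
  qed
  then show ?thesis using that by blast
qed

section \<open>Bivariate polynomials as elements of \<open>\<real>[x][y]\<close>\<close>

text \<open>The outer variable is y and the inner one x: \<open>coeff (coeff p j) i\<close> belongs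
  to x^i y^j. The nested type carries a gcd, from which the common factor is obtained later.\<close>

definition eval2 :: "real poly poly \<Rightarrow> real \<Rightarrow> real \<Rightarrow> real" where
  "eval2 p x y = poly (poly p [:y:]) x"

lemma eval2_simps [simp]:
  "eval2 0 x y = 0" "eval2 1 x y = 1"
  "eval2 (p + q) x y = eval2 p x y + eval2 q x y"
  "eval2 (p - q) x y = eval2 p x y - eval2 q x y"
  "eval2 (- p) x y = - eval2 p x y"
  "eval2 (p * q) x y = eval2 p x y * eval2 q x y"
  "eval2 (p ^ n) x y = eval2 p x y ^ n"
  "eval2 (pCons a p) x y = poly a x + y * eval2 p x y"
  "eval2 (smult a p) x y = poly a x * eval2 p x y"
  by (simp_all add: eval2_def algebra_simps)

lemma eval2_sum [simp]: "eval2 (sum f S) x y = (\<Sum>s\<in>S. eval2 (f s) x y)"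
  by (simp add: eval2_def poly_sum)

lemma eval2_prod [simp]: "eval2 (prod f S) x y = (\<Prod>s\<in>S. eval2 (f s) x y)"
  by (simp add: eval2_def poly_prod)

definition substitute2 :: "real poly poly \<Rightarrow> real poly \<Rightarrow> real poly \<Rightarrow> real poly" where
  "substitute2 p A B = (\<Sum>j\<le>degree p. pcompose (coeff p j) A * B ^ j)"

lemma poly_substitute2 [simp]: "poly (substitute2 p A B) t = eval2 p (poly A t) (poly B t)"
  unfolding substitute2_def eval2_def poly_altdef[of p]
  by (simp add: poly_sum poly_pcompose poly_power)

text \<open>\<open>degree p\<close> sees only y. The total degree is tracked as an upper bound,
  which 0 satisfies for every \<open>n\<close>.\<close>

definition total_degree_le :: "nat \<Rightarrow> real poly poly \<Rightarrow> bool" where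
  "total_degree_le n p \<longleftrightarrow> (\<forall>i j. coeff (coeff p j) i \<noteq> 0 \<longrightarrow> i + j \<le> n)"

lemma total_degree_le_mono: "total_degree_le m p \<Longrightarrow> m \<le> n \<Longrightarrow> total_degree_le n p"
  by (force simp: total_degree_le_def)

lemma total_degree_le_0 [simp]: "total_degree_le n 0"
  by (simp add: total_degree_le_def)

lemma total_degree_le_add:
  "total_degree_le n p \<Longrightarrow> total_degree_le n q \<Longrightarrow> total_degree_le n (p + q)"
  unfolding total_degree_le_def by (metis add_0 coeff_add)

lemma total_degree_le_uminus: "total_degree_le n p \<Longrightarrow> total_degree_le n (- p)"
  by (simp add: total_degree_le_def)

lemma total_degree_le_sum:
  "(\<And>s. s \<in> S \<Longrightarrow> total_degree_le n (f s)) \<Longrightarrow> total_degree_le n (sum f S)"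
  by (induction S rule: infinite_finite_induct) (auto intro: total_degree_le_add)

lemma total_degree_le_mult:
  assumes "total_degree_le m p" and "total_degree_le n q"
  shows "total_degree_le (m + n) (p * q)"
  unfolding total_degree_le_def
proof (intro allI impI)
  fix i j
  assume "coeff (coeff (p * q) j) i \<noteq> 0"
  then have "(\<Sum>k\<le>j. \<Sum>l\<le>i. coeff (coeff p k) l * coeff (coeff q (j - k)) (i - l)) \<noteq> 0"
    by (simp add: coeff_mult coeff_sum)
  then obtain k where k: "k \<le> j" "(\<Sum>l\<le>i. coeff (coeff p k) l * coeff (coeff q (j - k)) (i - l)) \<noteq> 0"
    by (metis (no_types, lifting) atMost_iff sum.neutral)
  then obtain l where l: "l \<le> i" "coeff (coeff p k) l * coeff (coeff q (j - k)) (i - l) \<noteq> 0"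
    by (metis (no_types, lifting) atMost_iff sum.neutral)
  then have "l + k \<le> m" "(i - l) + (j - k) \<le> n"
    using assms unfolding total_degree_le_def by (metis mult_eq_0_iff)+
  then show "i + j \<le> m + n"
    using k l by linarith
qed

lemma total_degree_le_smult:
  assumes "total_degree_le n p"
  shows "total_degree_le n (smult [:c:] p)"
  using assms by (auto simp: total_degree_le_def)

lemma total_degree_le_power: "total_degree_le m p \<Longrightarrow> total_degree_le (n * m) (p ^ n)"
  by (induction n) (auto simp: total_degree_le_def[of _ 1] coeff_1 split: if_splits intro: total_degree_le_mult)

lemma total_degree_le_prod:
  "(\<And>s. s \<in> S \<Longrightarrow> total_degree_le m (f s)) \<Longrightarrow> total_degree_le (card S * m) (prod f S)"
proof (induction S rule: infinite_finite_induct)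
  case (insert s S)
  then show ?case using total_degree_le_mult[of m "f s"] by auto
qed (auto simp: total_degree_le_def coeff_1 split: if_splits)

lemma degree_coeff_total_degree_le:
  assumes "total_degree_le n p"
  shows "degree (coeff p j) \<le> n - j" and "n < j \<Longrightarrow> coeff p j = 0"
proof -
  show "degree (coeff p j) \<le> n - j"
    using assms by (intro degree_le) (force simp: total_degree_le_def)
  show "coeff p j = 0" if "n < j"
  proof (rule poly_eqI)
    show "coeff (coeff p j) i = coeff 0 i" for i
      using assms that by (force simp: total_degree_le_def)
  qed
qed

lemma degree_le_total_degree: "total_degree_le n p \<Longrightarrow> degree p \<le> n"
  by (meson degree_coeff_total_degree_le(2) degree_le)

lemma eval2_total_degree_le:
  assumes "total_degree_le n p"
  shows "eval2 p x y = (\<Sum>j\<le>n. \<Sum>i\<le>n - j. coeff (coeff p j) i * x ^ i * y ^ j)"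
proof -
  have "poly p [:y:] = (\<Sum>j\<le>n. coeff p j * [:y:] ^ j)"
    unfolding poly_altdef using degree_le_total_degree[OF assms]
    by (intro sum.mono_neutral_left) (auto simp: coeff_eq_0 not_le)
  moreover have "poly (coeff p j) x = (\<Sum>i\<le>n - j. coeff (coeff p j) i * x ^ i)" for j
    unfolding poly_altdef using degree_coeff_total_degree_le(1)[OF assms, of j]
    by (intro sum.mono_neutral_left) (auto simp: coeff_eq_0 not_le)
  ultimately show ?thesis
    by (simp add: eval2_def poly_sum sum_distrib_right)
qed

text \<open>The homogenisation of p at (A : B : C), that is, p(A/C, B/C) with the denominator C^n
  cleared. It stays meaningful at the roots of C, where the curve passes through infinity.\<close>

definition homogenize :: "nat \<Rightarrow> real poly poly \<Rightarrow> real poly \<Rightarrow> real poly \<Rightarrow> real poly \<Rightarrow> real poly" where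
  "homogenize n p A B C =
     (\<Sum>j\<le>n. \<Sum>i\<le>n - j. smult (coeff (coeff p j) i) (A ^ i * B ^ j * C ^ (n - i - j)))"

lemma degree_homogenize:
  assumes "degree A \<le> e" "degree B \<le> e" "degree C \<le> e"
  shows "degree (homogenize n p A B C) \<le> n * e"
  unfolding homogenize_def
proof (intro degree_sum_le)
  fix i j assume *: "j \<in> {..n}" "i \<in> {..n - j}"
  have "degree (A ^ i * B ^ j * C ^ (n - i - j)) \<le> i * e + j * e + (n - i - j) * e"
    by (intro degree_mult_le[THEN order_trans] add_mono degree_power_le[THEN order_trans])
       (use assms in \<open>auto simp: mult.commute mult_le_mono\<close>)
  also have "\<dots> = n * e"
    using * by (simp flip: add_mult_distrib)
  finally show "degree (smult (coeff (coeff p j) i) (A ^ i * B ^ j * C ^ (n - i - j))) \<le> n * e"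
    using degree_smult_le order_trans by blast
qed auto

lemma poly_homogenize:
  assumes "total_degree_le n p" and "poly C t \<noteq> 0"
  shows "poly (homogenize n p A B C) t =
           poly C t ^ n * eval2 p (poly A t / poly C t) (poly B t / poly C t)"
proof -
  have *: "a ^ i * b ^ j * c ^ (n - i - j) = c ^ n * ((a / c) ^ i * (b / c) ^ j)"
    if "c \<noteq> 0" "j \<le> n" "i \<le> n - j" for a b c :: real and i j
  proof -
    have "c ^ n = c ^ i * c ^ j * c ^ (n - i - j)"
      using that by (simp flip: power_add)
    then show ?thesis using that by (simp add: power_divide)
  qed
  have "poly (homogenize n p A B C) t =
    (\<Sum>j\<le>n. \<Sum>i\<le>n - j. coeff (coeff p j) i * (poly A t ^ i * poly B t ^ j * poly C t ^ (n - i - j)))"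
    by (simp add: homogenize_def poly_sum)
  also have "\<dots> = (\<Sum>j\<le>n. \<Sum>i\<le>n - j. poly C t ^ n *
      (coeff (coeff p j) i * (poly A t / poly C t) ^ i * (poly B t / poly C t) ^ j))"
  proof (intro sum.cong refl)
    fix i j assume "j \<in> {..n}" "i \<in> {..n - j}"
    then have ij: "j \<le> n" "i \<le> n - j" by auto
    show "coeff (coeff p j) i * (poly A t ^ i * poly B t ^ j * poly C t ^ (n - i - j)) =
      poly C t ^ n * (coeff (coeff p j) i * (poly A t / poly C t) ^ i * (poly B t / poly C t) ^ j)"
      unfolding *[OF assms(2) ij] by (simp only: ac_simps)
  qed
  finally show ?thesis
    by (simp add: eval2_total_degree_le[OF assms(1)] sum_distrib_left)
qed

section \<open>Zeros of semidefinite conics and quartics\<close>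

definition zeros2 :: "real poly poly \<Rightarrow> (real \<times> real) set" where
  "zeros2 p = {(x, y). eval2 p x y = 0}"

text \<open>On a rational curve of degree \<open>e\<close>, a nonnegative polynomial of degree \<open>n\<close> becomes a
  nonnegative univariate polynomial of degree at most \<open>n * e\<close>, all of whose roots are double.\<close>

lemma card_zeros_on_rational_curve:
  assumes deg: "total_degree_le n p" and "even n" and nonneg: "\<And>x y. 0 \<le> eval2 p x y"
    and fin: "finite (zeros2 p)"
    and degs: "degree A \<le> e" "degree B \<le> e" "degree C \<le> e"
    and "C \<noteq> 0" and nonconst: "\<And>a b. \<not> (A = smult a C \<and> B = smult b C)"
    and T: "finite T" "\<And>t. t \<in> T \<Longrightarrow> poly (homogenize n p A B C) t = 0"
  shows "2 * card T \<le> n * e"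
proof -
  let ?\<phi> = "homogenize n p A B C"
  let ?U = "{t. poly C t \<noteq> 0}"
  have finC: "finite {t. poly C t = 0}"
    using \<open>C \<noteq> 0\<close> by (rule poly_roots_finite)
  have "0 \<le> poly ?\<phi> t" if "t \<notin> {t. poly C t = 0}" for t
    using that nonneg \<open>even n\<close> by (simp add: poly_homogenize[OF deg] zero_le_even_power)
  then have \<phi>_nonneg: "0 \<le> poly ?\<phi> t" for t
    using finC poly_nonneg_cofinite by blast
  \<comment> \<open>Otherwise the whole curve lies in the finite zero set, so it takes one value (a,
    b) infinitely often; then A - aC and B - bC have infinitely many roots and vanish, and the
    parametrisation is constant.\<close>
  have "?\<phi> \<noteq> 0"
  proof
    assume "?\<phi> = 0"
    define P where "P t = (poly A t / poly C t, poly B t / poly C t)" for t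
    have "P ` ?U \<subseteq> zeros2 p"
    proof
      fix z assume "z \<in> P ` ?U"
      then obtain t where t: "poly C t \<noteq> 0" "z = P t" by blast
      have "poly C t ^ n * eval2 p (poly A t / poly C t) (poly B t / poly C t) = 0"
        using poly_homogenize[OF deg t(1), of A B] \<open>?\<phi> = 0\<close> by simp
      then show "z \<in> zeros2 p"
        using t by (simp add: P_def zeros2_def)
    qed
    then have "finite (P ` ?U)"
      using fin finite_subset by blast
    moreover have "infinite ?U"
    proof
      assume "finite ?U"
      then have "finite ({t. poly C t = 0} \<union> ?U)" using finC by blast
      moreover have "{t. poly C t = 0} \<union> ?U = UNIV" by auto
      ultimately show False using infinite_UNIV_char_0 by metis
    qed
    ultimately obtain s where s: "s \<in> ?U" "infinite {t \<in> ?U. P t = P s}"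
      using pigeonhole_infinite by blast
    define a b where "a = poly A s / poly C s" and "b = poly B s / poly C s"
    have "{t \<in> ?U. P t = P s} \<subseteq> {t. poly (A - smult a C) t = 0}"
         "{t \<in> ?U. P t = P s} \<subseteq> {t. poly (B - smult b C) t = 0}"
      unfolding P_def a_def b_def by (auto simp: field_simps)
    then have "A - smult a C = 0" "B - smult b C = 0"
      using s(2) poly_roots_finite finite_subset by blast+
    then show False using nonconst[of a b] by simp
  qed
  have "2 * card T \<le> degree ?\<phi>"
    by (rule nonneg_poly_card_roots) (use T \<phi>_nonneg \<open>?\<phi> \<noteq> 0\<close> in auto)
  also have "\<dots> \<le> n * e"
    by (rule degree_homogenize) fact+
  finally show ?thesis .
qed

lemma card_zeros_on_line:
  assumes deg: "total_degree_le n p" and "even n" and nonneg: "\<And>x y. 0 \<le> eval2 p x y"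
    and fin: "finite (zeros2 p)"
    and dir: "(c, d) \<noteq> (0, 0)"
    and T: "finite T" "\<And>t. t \<in> T \<Longrightarrow> (a + t * c, b + t * d) \<in> zeros2 p"
  shows "2 * card T \<le> n"
proof -
  have "2 * card T \<le> n * 1"
  proof (rule card_zeros_on_rational_curve[OF deg \<open>even n\<close> nonneg fin])
    show "degree [:a, c:] \<le> 1" "degree [:b, d:] \<le> 1" "degree (1::real poly) \<le> 1" by auto
    show "\<not> ([:a, c:] = smult \<alpha> 1 \<and> [:b, d:] = smult \<beta> 1)" for \<alpha> \<beta>
      using dir by (auto simp: one_pCons split: if_splits)
    show "poly (homogenize n p [:a, c:] [:b, d:] 1) t = 0" if "t \<in> T" for t
      using T(2)[OF that] by (simp add: poly_homogenize[OF deg] zeros2_def)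
  qed (use T in auto)
  then show ?thesis by simp
qed

lemma translate_pairE:
  fixes w :: "real \<times> real"
  obtains c d where "w = (a + c, b + d)"
  by (rule that[of "fst w - a" "snd w - b"]) simp

text \<open>The line joining two zeros would carry two double roots of a polynomial of degree at
  most 2.\<close>

lemma card_zeros_nonneg_conic:
  assumes deg: "total_degree_le 2 p" and nonneg: "\<And>x y. 0 \<le> eval2 p x y"
    and fin: "finite (zeros2 p)"
  shows "card (zeros2 p) \<le> 1"
proof (rule ccontr)
  assume "\<not> card (zeros2 p) \<le> 1"
  then obtain z w where zw: "z \<in> zeros2 p" "w \<in> zeros2 p" "z \<noteq> w"
    using card_le_Suc0_iff_eq[OF fin] by auto
  obtain a b where z: "z = (a, b)" by force
  obtain c d where w: "w = (a + c, b + d)" by (rule translate_pairE)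
  have "2 * card {0::real, 1} \<le> 2"
  proof (rule card_zeros_on_line[OF deg _ nonneg fin])
    show "(c, d) \<noteq> (0, 0)" using zw(3) z w by auto
    show "(a + t * c, b + t * d) \<in> zeros2 p" if "t \<in> {0, 1}" for t
      using that zw(1,2)[unfolded z w] by auto
  qed auto
  then show False by simp
qed

text \<open>Twice the signed area of the triangle. Besides testing collinearity, its values serve as
  unnormalised barycentric coordinates.\<close>

definition collinear_det :: "real \<times> real \<Rightarrow> real \<times> real \<Rightarrow> real \<times> real \<Rightarrow> real" where
  "collinear_det a b c =
     (fst b - fst a) * (snd c - snd a) - (fst c - fst a) * (snd b - snd a)"

text \<open>Three zeros on a line would be three double roots in degree at most 4.\<close>

lemma nonneg_quartic_zeros_not_collinear:
  assumes deg: "total_degree_le 4 p" and nonneg: "\<And>x y. 0 \<le> eval2 p x y"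
    and fin: "finite (zeros2 p)"
    and zeros: "u \<in> zeros2 p" "v \<in> zeros2 p" "w \<in> zeros2 p" and neq: "u \<noteq> v" "u \<noteq> w" "v \<noteq> w"
  shows "collinear_det u v w \<noteq> 0"
proof
  assume det: "collinear_det u v w = 0"
  obtain a b where u: "u = (a, b)" by force
  obtain c d where v: "v = (a + c, b + d)" by (rule translate_pairE)
  obtain e f where w: "w = (a + e, b + f)" by (rule translate_pairE)
  have cd: "c * f = e * d"
    using det by (simp add: collinear_det_def u v w)
  have dir: "(c, d) \<noteq> (0, 0)" using neq(1) u v by auto
  have "\<exists>t. e = t * c \<and> f = t * d"
  proof (cases "c = 0")
    case True
    then have "d \<noteq> 0" using dir by auto
    then show ?thesis using cd True by (intro exI[of _ "f / d"]) auto
  next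
    case False
    then show ?thesis using cd by (intro exI[of _ "e / c"]) (auto simp: field_simps)
  qed
  then obtain t where t: "e = t * c" "f = t * d" by blast
  have "t \<noteq> 0" "t \<noteq> 1" using neq t u v w by auto
  have "2 * card {0, 1, t} \<le> 4"
  proof (rule card_zeros_on_line[OF deg _ nonneg fin dir])
    show "(a + s * c, b + s * d) \<in> zeros2 p" if "s \<in> {0, 1, t}" for s
      using that zeros[unfolded u v w t] by auto
  qed auto
  then show False using \<open>t \<noteq> 0\<close> \<open>t \<noteq> 1\<close> by simp
qed

text \<open>The Cremona map is an involution: at (1/a : 1/b : 1/c) it returns (a : b : c) up to the
  factor 1/(abc). The weights \<open>x\<close>, \<open>y\<close>, \<open>z\<close> will be
  coordinates of the three base points.\<close>

lemma sum_of_paired_inverses: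
  fixes a b c :: real
  assumes "a \<noteq> 0" "b \<noteq> 0" "c \<noteq> 0"
  shows "x * (1 / b * (1 / c)) + y * (1 / a * (1 / c)) + z * (1 / a * (1 / b)) = (a * x + b * y + c * z) / (a * b * c)"
  using assms by (simp add: add_divide_distrib)

lemma cremona_line_at_inverse:
  fixes a b c :: real
  assumes "a \<noteq> 0" "b \<noteq> 0" "c \<noteq> 0"
  shows "poly [:1 / a, 1 / b - c / a:] (1 / c) = 1 / (c * b)"
  using assms by (simp add: field_simps)

lemma cremona_line_root:
  fixes a b c t :: real
  assumes "a \<noteq> 0" "b \<noteq> 0" "c * b - a \<noteq> 0"
  shows "poly [:1 / a, 1 / b - c / a:] t = 0 \<longleftrightarrow> t = b / (c * b - a)"
proof -
  have "poly [:1 / a, 1 / b - c / a:] t = (b - t * (c * b - a)) / (a * b)"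
    using assms by (simp add: field_simps)
  then show ?thesis
    using assms by (auto simp: eq_divide_eq)
qed

text \<open>Through five points, no three of them collinear, passes a rational conic. In the coordinates
  given by the first three points it is the image of a line under the Cremona transformation
  \<open>(u : v : w) \<mapsto> (v w : u w : u v)\<close>; the first three points correspond to the roots of
  \<open>u\<close>, \<open>v\<close> and \<open>w\<close>.\<close>

lemma card_zeros_nonneg_quartic:
  assumes deg: "total_degree_le 4 p" and nonneg: "\<And>x y. 0 \<le> eval2 p x y"
    and fin: "finite (zeros2 p)"
  shows "card (zeros2 p) \<le> 4"
proof (rule ccontr)
  assume "\<not> card (zeros2 p) \<le> 4"
  then have "5 \<le> card (zeros2 p)" by simp
  then obtain Z where Z: "Z \<subseteq> zeros2 p" "card Z = 5" "finite Z"
    using obtain_subset_with_card_n by metis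
  then obtain zs where zs: "set zs = Z" "distinct zs" "length zs = 5"
    using finite_distinct_list distinct_card by metis
  then obtain p1 p2 p3 p4 p5 where "zs = [p1, p2, p3, p4, p5]"
    by (auto simp: length_Suc_conv numeral_eq_Suc)
  then have Zeq: "Z = {p1, p2, p3, p4, p5}" and dist: "distinct [p1, p2, p3, p4, p5]"
    using zs by auto
  have zs: "p1 \<in> zeros2 p" "p2 \<in> zeros2 p" "p3 \<in> zeros2 p" "p4 \<in> zeros2 p" "p5 \<in> zeros2 p"
    using Z(1) Zeq by auto
  note ncol = nonneg_quartic_zeros_not_collinear[OF deg nonneg fin]
  obtain x1 y1 x2 y2 x3 y3 x4 y4 x5 y5 where
    p: "p1 = (x1, y1)" "p2 = (x2, y2)" "p3 = (x3, y3)" "p4 = (x4, y4)" "p5 = (x5, y5)"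
    by (metis surj_pair)
  \<comment> \<open>By Cramer's rule the \<open>a1\<close>, \<open>a2\<close>, \<open>a3\<close> and
    \<open>b1\<close>, \<open>b2\<close>, \<open>b3\<close> are \<delta> times the barycentric
    coordinates of \<open>p4\<close> and \<open>p5\<close> with respect to \<open>p1\<close>,
    \<open>p2\<close>, \<open>p3\<close>. Noncollinearity makes all of them nonzero, hence
    invertible.\<close>
  define \<delta> where "\<delta> = collinear_det p1 p2 p3"
  define a1 a2 a3 where "a1 = collinear_det p4 p2 p3"
    and "a2 = collinear_det p1 p4 p3" and "a3 = collinear_det p1 p2 p4"
  define b1 b2 b3 where "b1 = collinear_det p5 p2 p3"
    and "b2 = collinear_det p1 p5 p3" and "b3 = collinear_det p1 p2 p5"
  have nz: "\<delta> \<noteq> 0" "a1 \<noteq> 0" "a2 \<noteq> 0" "a3 \<noteq> 0" "b1 \<noteq> 0" "b2 \<noteq> 0" "b3 \<noteq> 0"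
    unfolding \<delta>_def a1_def a2_def a3_def b1_def b2_def b3_def
    using dist ncol[OF zs(1,2,3)] ncol[OF zs(4,2,3)] ncol[OF zs(1,4,3)] ncol[OF zs(1,2,4)]
      ncol[OF zs(5,2,3)] ncol[OF zs(1,5,3)] ncol[OF zs(1,2,5)] by auto
  \<comment> \<open>Each minor vanishes only if \<open>p4\<close> and \<open>p5\<close> are
    collinear with a base point. Its nonvanishing will keep the roots of \<open>u\<close>,
    \<open>v\<close>, \<open>w\<close> distinct.\<close>
  have cross: "a1 * b2 - a2 * b1 \<noteq> 0" "a1 * b3 - a3 * b1 \<noteq> 0" "a2 * b3 - a3 * b2 \<noteq> 0"
  proof -
    have eq: "a1 * b2 - a2 * b1 = \<delta> * collinear_det p3 p4 p5"
      "a1 * b3 - a3 * b1 = - \<delta> * collinear_det p2 p4 p5"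
      "a2 * b3 - a3 * b2 = \<delta> * collinear_det p1 p4 p5"
      unfolding \<delta>_def a1_def a2_def a3_def b1_def b2_def b3_def collinear_det_def p
      by (simp_all add: algebra_simps)
    have "collinear_det p3 p4 p5 \<noteq> 0" "collinear_det p2 p4 p5 \<noteq> 0" "collinear_det p1 p4 p5 \<noteq> 0"
      using dist ncol[OF zs(3,4,5)] ncol[OF zs(2,4,5)] ncol[OF zs(1,4,5)] by auto
    then show "a1 * b2 - a2 * b1 \<noteq> 0" "a1 * b3 - a3 * b1 \<noteq> 0" "a2 * b3 - a3 * b2 \<noteq> 0"
      using nz by (auto simp: eq)
  qed
  have bary4: "\<delta> * x4 = a1 * x1 + a2 * x2 + a3 * x3" "\<delta> * y4 = a1 * y1 + a2 * y2 + a3 * y3"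
    "\<delta> = a1 + a2 + a3"
    unfolding \<delta>_def a1_def a2_def a3_def collinear_det_def p by (simp_all add: algebra_simps)
  have bary5: "\<delta> * x5 = b1 * x1 + b2 * x2 + b3 * x3" "\<delta> * y5 = b1 * y1 + b2 * y2 + b3 * y3"
    "\<delta> = b1 + b2 + b3"
    unfolding \<delta>_def b1_def b2_def b3_def collinear_det_def p by (simp_all add: algebra_simps)
  \<comment> \<open>The free scale \<open>c\<close> places everything at finite parameters:
    \<open>c \<noteq> 0\<close> does so for \<open>p5\<close>, at 1/c, and the other three
    exclusions make \<open>u\<close>, \<open>v\<close>, \<open>w\<close> nonconstant, so that each
    has a root.\<close>
  have "infinite (UNIV - {0, a1 / b1, a2 / b2, a3 / b3})"
    by (simp add: infinite_UNIV_char_0)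
  then have "UNIV - {0, a1 / b1, a2 / b2, a3 / b3} \<noteq> {}"
    by (rule infinite_imp_nonempty)
  then obtain c where c: "c \<noteq> 0" "c \<noteq> a1 / b1" "c \<noteq> a2 / b2" "c \<noteq> a3 / b3"
    by blast
  \<comment> \<open>These are the coordinates (1 - ct)/a + t/b of the line joining the Cremona
    images of \<open>p4\<close>, reached at t = 0, and \<open>p5\<close>, reached at t =
    1/c.\<close>
  define u v w where "u = [:1 / a1, 1 / b1 - c / a1:]" and "v = [:1 / a2, 1 / b2 - c / a2:]"
    and "w = [:1 / a3, 1 / b3 - c / a3:]"
  define A B C where "A = smult x1 (v * w) + smult x2 (u * w) + smult x3 (u * v)"
    and "B = smult y1 (v * w) + smult y2 (u * w) + smult y3 (u * v)"
    and "C = v * w + u * w + u * v"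
  define \<tau> where "\<tau> a b = b / (c * b - a)" for a b :: real
  have den: "c * b1 - a1 \<noteq> 0" "c * b2 - a2 \<noteq> 0" "c * b3 - a3 \<noteq> 0"
    using c nz by (auto simp: eq_divide_eq)
  have ev0: "poly u 0 = 1 / a1" "poly v 0 = 1 / a2" "poly w 0 = 1 / a3"
    by (simp_all add: u_def v_def w_def)
  have ev1: "poly u (1 / c) = 1 / (c * b1)" "poly v (1 / c) = 1 / (c * b2)" "poly w (1 / c) = 1 / (c * b3)"
    unfolding u_def v_def w_def by (intro cremona_line_at_inverse c(1) nz)+
  have root: "poly u t = 0 \<longleftrightarrow> t = \<tau> a1 b1" "poly v t = 0 \<longleftrightarrow> t = \<tau> a2 b2" "poly w t = 0 \<longleftrightarrow> t = \<tau> a3 b3" for t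
    unfolding u_def v_def w_def \<tau>_def by (intro cremona_line_root nz den)+
  have \<tau>0: "\<tau> a1 b1 \<noteq> 0" "\<tau> a2 b2 \<noteq> 0" "\<tau> a3 b3 \<noteq> 0"
    using nz den by (auto simp: \<tau>_def)
  have \<tau>1: "\<tau> a1 b1 \<noteq> 1 / c" "\<tau> a2 b2 \<noteq> 1 / c" "\<tau> a3 b3 \<noteq> 1 / c"
    using nz den c(1) by (simp_all add: \<tau>_def frac_eq_eq)
  have \<tau>2: "\<tau> a1 b1 \<noteq> \<tau> a2 b2" "\<tau> a1 b1 \<noteq> \<tau> a3 b3" "\<tau> a2 b2 \<noteq> \<tau> a3 b3"
    using cross den by (simp_all add: \<tau>_def frac_eq_eq right_diff_distrib mult.commute mult.left_commute)
  let ?T = "{0, 1 / c, \<tau> a1 b1, \<tau> a2 b2, \<tau> a3 b3}"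
  have card: "card ?T = 5"
    using \<tau>0 \<tau>1 \<tau>2 c by auto
  have val: "poly (homogenize 4 p A B C) t = 0"
    if "poly C t \<noteq> 0" "poly A t = poly C t * x" "poly B t = poly C t * y" "(x, y) \<in> zeros2 p" for t x y
    using that by (simp add: poly_homogenize[OF deg] zeros2_def)
  have at0: "poly C 0 = \<delta> / (a1 * a2 * a3)" "poly A 0 = \<delta> * x4 / (a1 * a2 * a3)"
    "poly B 0 = \<delta> * y4 / (a1 * a2 * a3)"
    using sum_of_paired_inverses[OF nz(2-4), of 1 1 1] sum_of_paired_inverses[OF nz(2-4), of x1 x2 x3]
      sum_of_paired_inverses[OF nz(2-4), of y1 y2 y3]
    by (simp_all only: A_def B_def C_def poly_add poly_smult poly_mult ev0 bary4(1,2) mult_1 mult_1_right flip: bary4(3))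
  have cb: "c * b1 \<noteq> 0" "c * b2 \<noteq> 0" "c * b3 \<noteq> 0"
    using c nz by auto
  have bary5': "c * (\<delta> * x5) = c * b1 * x1 + c * b2 * x2 + c * b3 * x3"
    "c * (\<delta> * y5) = c * b1 * y1 + c * b2 * y2 + c * b3 * y3" "c * \<delta> = c * b1 + c * b2 + c * b3"
    by (simp_all only: bary5(1,2) distrib_left mult.assoc) (simp only: bary5(3) distrib_left)
  have at1: "poly C (1 / c) = c * \<delta> / (c * b1 * (c * b2) * (c * b3))"
    "poly A (1 / c) = c * (\<delta> * x5) / (c * b1 * (c * b2) * (c * b3))"
    "poly B (1 / c) = c * (\<delta> * y5) / (c * b1 * (c * b2) * (c * b3))"
    using sum_of_paired_inverses[OF cb, of 1 1 1] sum_of_paired_inverses[OF cb, of x1 x2 x3]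
      sum_of_paired_inverses[OF cb, of y1 y2 y3]
    by (simp_all only: A_def B_def C_def poly_add poly_smult poly_mult ev1 bary5' mult_1 mult_1_right)
  have A0: "poly A 0 = poly C 0 * x4" and B0: "poly B 0 = poly C 0 * y4"
    and A1: "poly A (1 / c) = poly C (1 / c) * x5" and B1: "poly B (1 / c) = poly C (1 / c) * y5"
    by (simp_all add: at0 at1)
  have C_nz: "poly C 0 \<noteq> 0" "poly C (1 / c) \<noteq> 0"
    using nz c by (simp_all add: at0 at1)
  \<comment> \<open>A quartic restricted to a conic has degree at most 8, too small for five double
    roots.\<close>
  have "2 * card ?T \<le> 4 * 2"
  proof (rule card_zeros_on_rational_curve[OF deg _ nonneg fin])
    have d: "degree u \<le> 1" "degree v \<le> 1" "degree w \<le> 1"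
      by (simp_all add: u_def v_def w_def)
    have d2: "degree (v * w) \<le> 2" "degree (u * w) \<le> 2" "degree (u * v) \<le> 2"
      using degree_mult_le[of v w] degree_mult_le[of u w] degree_mult_le[of u v] d by linarith+
    show "degree A \<le> 2" "degree B \<le> 2" "degree C \<le> 2"
      unfolding A_def B_def C_def
      by (intro degree_add_le degree_smult_le[THEN order_trans] d2)+
    show "C \<noteq> 0" using C_nz by auto
    show "\<not> (A = smult \<alpha> C \<and> B = smult \<beta> C)" for \<alpha> \<beta>
    proof
      assume "A = smult \<alpha> C \<and> B = smult \<beta> C"
      then have "x4 = \<alpha>" "y4 = \<beta>" "x5 = \<alpha>" "y5 = \<beta>"
        using A0 B0 A1 B1 C_nz by auto
      then show False using dist p by simp
    qed
    show "poly (homogenize 4 p A B C) t = 0" if t: "t \<in> ?T" for t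
    proof -
      consider "t = 0" | "t = 1 / c" | "t = \<tau> a1 b1" | "t = \<tau> a2 b2" | "t = \<tau> a3 b3"
        using t by blast
      then show ?thesis
      proof cases
        case 1
        then show ?thesis using val[of 0 x4 y4] A0 B0 C_nz zs p by simp
      next
        case 2
        then show ?thesis using val[of "1/c" x5 y5] A1 B1 C_nz zs p by simp
      next
        case 3
        then have "poly u t = 0" "poly v t \<noteq> 0" "poly w t \<noteq> 0" using root \<tau>2 by auto
        then show ?thesis using val[of t x1 y1] zs p by (simp add: A_def B_def C_def)
      next
        case 4
        then have "poly u t \<noteq> 0" "poly v t = 0" "poly w t \<noteq> 0" using root \<tau>2 by auto
        then show ?thesis using val[of t x2 y2] zs p by (simp add: A_def B_def C_def)
      next
        case 5
        then have "poly u t \<noteq> 0" "poly v t \<noteq> 0" "poly w t = 0" using root \<tau>2 by auto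
        then show ?thesis using val[of t x3 y3] zs p by (simp add: A_def B_def C_def)
      qed
    qed
  qed auto
  then show False using card by simp
qed

section \<open>A Bezout inequality for double points\<close>

text \<open>Gaussian elimination: an unknown \<open>k\<close> with nonzero coefficient in condition
  \<open>j\<close> is eliminated from the other conditions, and its value is chosen at the end so as
  to satisfy \<open>j\<close>.\<close>

lemma homogeneous_system_nontrivial:
  fixes a :: "'i \<Rightarrow> 'j \<Rightarrow> 'a::field"
  assumes "finite J" "finite I" "card J < card I"
  shows "\<exists>c. (\<exists>i\<in>I. c i \<noteq> 0) \<and> (\<forall>j\<in>J. (\<Sum>i\<in>I. c i * a i j) = 0)"
  using assms
proof (induction J arbitrary: I a)
  case empty
  then have "I \<noteq> {}" by auto
  then show ?case by (intro exI[of _ "\<lambda>_. 1"]) auto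
next
  case (insert j J)
  show ?case
  proof (cases "\<forall>i\<in>I. a i j = 0")
    case True
    obtain c where "\<exists>i\<in>I. c i \<noteq> 0" "\<forall>j\<in>J. (\<Sum>i\<in>I. c i * a i j) = 0"
      using insert.IH[of I a] insert.prems insert.hyps by auto
    then show ?thesis using True by (intro exI[of _ c]) auto
  next
    case False
    then obtain k where k: "k \<in> I" "a k j \<noteq> 0" by blast
    let ?I = "I - {k}"
    have "card J < card ?I"
      using insert.prems insert.hyps k by simp
    then obtain c where c: "\<exists>i\<in>?I. c i \<noteq> 0"
        and c0: "\<And>l. l \<in> J \<Longrightarrow> (\<Sum>i\<in>?I. c i * (a i l - a i j / a k j * a k l)) = 0"
      using insert.IH[of ?I "\<lambda>i l. a i l - a i j / a k j * a k l"] insert.prems by auto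
    define s where "s = (\<Sum>i\<in>?I. c i * a i j)"
    define c' where "c' = c(k := - s / a k j)"
    have sum': "(\<Sum>i\<in>I. c' i * a i l) = - s / a k j * a k l + (\<Sum>i\<in>?I. c i * a i l)" for l
    proof -
      have "(\<Sum>i\<in>?I. c' i * a i l) = (\<Sum>i\<in>?I. c i * a i l)"
        by (intro sum.cong) (auto simp: c'_def)
      then show ?thesis
        using insert.prems k by (simp add: sum.remove[of I k] c'_def)
    qed
    have "(\<Sum>i\<in>I. c' i * a i l) = 0" if "l \<in> insert j J" for l
    proof (cases "l = j")
      case True
      then show ?thesis using k by (simp add: sum' s_def)
    next
      case False
      then have l: "l \<in> J" using that by blast
      have "(\<Sum>i\<in>?I. c i * (a i l - a i j / a k j * a k l)) =
          (\<Sum>i\<in>?I. c i * a i l - (c i * a i j) * (a k l / a k j))"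
        by (intro sum.cong) (auto simp: algebra_simps)
      also have "\<dots> = (\<Sum>i\<in>?I. c i * a i l) - s * (a k l / a k j)"
        unfolding sum_subtractf s_def by (simp only: sum_distrib_right)
      finally show ?thesis
        using c0[OF l] by (simp add: sum')
    qed
    moreover have "\<exists>i\<in>I. c' i \<noteq> 0"
      using c by (auto simp: c'_def)
    ultimately show ?thesis by blast
  qed
qed

lemma finite_triangle: "finite {(i, j). i + j \<le> (n::nat)}"
  by (rule finite_subset[of _ "{..n} \<times> {..n}"]) auto

lemma poly2_family_dependent:
  assumes "finite I" and deg: "\<And>i. i \<in> I \<Longrightarrow> total_degree_le n (w i)"
    and "card {(i, j). i + j \<le> n} < card I"
  obtains c where "\<exists>i\<in>I. c i \<noteq> 0" and "(\<Sum>i\<in>I. smult [:c i:] (w i)) = 0"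
proof -
  have "\<exists>c. (\<exists>i\<in>I. c i \<noteq> 0) \<and>
      (\<forall>kl\<in>{(k, l). k + l \<le> n}. (\<Sum>i\<in>I. c i * coeff (coeff (w i) (snd kl)) (fst kl)) = 0)"
    by (rule homogeneous_system_nontrivial) (use assms finite_triangle in auto)
  then obtain c where c: "\<exists>i\<in>I. c i \<noteq> 0" and
    c0: "\<And>k l. k + l \<le> n \<Longrightarrow> (\<Sum>i\<in>I. c i * coeff (coeff (w i) l) k) = 0"
    by fastforce
  have "coeff (coeff (\<Sum>i\<in>I. smult [:c i:] (w i)) l) k = 0" for k l
  proof (cases "k + l \<le> n")
    case True
    then show ?thesis using c0 by (simp add: coeff_sum)
  next
    case False
    then have "coeff (coeff (w i) l) k = 0" if "i \<in> I" for i
      using deg[OF that] by (auto simp: total_degree_le_def)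
    then show ?thesis by (simp add: coeff_sum)
  qed
  then have "(\<Sum>i\<in>I. smult [:c i:] (w i)) = 0"
    by (intro poly_eqI) simp
  with c show ?thesis by (rule that)
qed

section \<open>Double points and second-order jets along lines\<close>

definition line_restriction :: "real poly poly \<Rightarrow> real \<times> real \<Rightarrow> real \<Rightarrow> real \<Rightarrow> real poly" where
  "line_restriction p z s r = substitute2 p [:fst z, s:] [:snd z, r:]"

lemma poly_line_restriction [simp]:
  "poly (line_restriction p z s r) t = eval2 p (fst z + t * s) (snd z + t * r)"
  by (simp add: line_restriction_def)

text \<open>Value and gradient vanish at \<open>z\<close>. Testing along all lines replaces partial
  derivatives and connects directly to double roots of univariate polynomials.\<close>

definition double_point :: "real poly poly \<Rightarrow> real \<times> real \<Rightarrow> bool" where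
  "double_point p z \<longleftrightarrow> (\<forall>s r. [:0, 1:] ^ 2 dvd line_restriction p z s r)"

lemma double_point_cofactor:
  assumes "double_point p z"
  obtains q where "line_restriction p z s r = pCons 0 (pCons 0 q)"
proof -
  obtain q where "line_restriction p z s r = [:0, 1:] ^ 2 * q"
    using assms unfolding double_point_def by (metis dvdE)
  then have "line_restriction p z s r = pCons 0 (pCons 0 q)"
    by (simp add: power2_eq_square)
  then show ?thesis by (rule that)
qed

lemma nonneg_zero_double_point:
  assumes "\<And>x y. 0 \<le> eval2 p x y" and "eval2 p (fst z) (snd z) = 0"
  shows "double_point p z"
  unfolding double_point_def
proof (intro allI)
  fix s r
  obtain q where "line_restriction p z s r = [:- 0, 1:] ^ 2 * q"
    by (rule nonneg_poly_double_root[of "line_restriction p z s r" 0]) (use assms in auto)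
  then show "[:0, 1:] ^ 2 dvd line_restriction p z s r"
    by simp
qed

definition local_x :: "real \<times> real \<Rightarrow> real poly poly" where
  "local_x z = [:[:- fst z, 1:]:]"

definition local_y :: "real \<times> real \<Rightarrow> real poly poly" where
  "local_y z = [:[:- snd z:], 1:]"

text \<open>The quadratic form with values \<open>a\<close>, \<open>b\<close>, \<open>c\<close> in the directions
  \<open>(1, 0)\<close>, \<open>(0, 1)\<close>, \<open>(1, 1)\<close>.\<close>

definition local_quadratic :: "real \<times> real \<Rightarrow> real \<Rightarrow> real \<Rightarrow> real \<Rightarrow> real poly poly" where
  "local_quadratic z a b c = smult [:a:] (local_x z ^ 2) + smult [:b:] (local_y z ^ 2)
     + smult [:c - a - b:] (local_x z * local_y z)"

text \<open>The quadratic parts at \<open>z\<close> of the multiples of \<open>f\<close> and \<open>g\<close> span at most two of three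
  dimensions. Together with the three conditions for a double point, this gives four linear
  conditions on the elements of the ideal generated by \<open>f\<close> and \<open>g\<close>.\<close>

lemma jet_coefficients_vanish:
  assumes eq: "A * f + B * g + local_x z ^ 3 * K
       + M * (smult [:c0:] 1 + smult [:c1:] (local_x z) + smult [:c2:] (local_y z)
         + smult [:c3:] (local_quadratic z l1 l2 l3)) = 0"
    and f: "double_point f z" and g: "double_point g z"
    and M: "eval2 M (fst z) (snd z) \<noteq> 0"
    and lf: "l1 * coeff (line_restriction f z 1 0) 2 + l2 * coeff (line_restriction f z 0 1) 2
        + l3 * coeff (line_restriction f z 1 1) 2 = 0"
    and lg: "l1 * coeff (line_restriction g z 1 0) 2 + l2 * coeff (line_restriction g z 0 1) 2
        + l3 * coeff (line_restriction g z 1 1) 2 = 0"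
    and l: "(l1, l2, l3) \<noteq> (0, 0, 0)"
  shows "c0 = 0 \<and> c1 = 0 \<and> c2 = 0 \<and> c3 = 0"
proof -
  let ?L = "\<lambda>p. line_restriction p z"
  define q where "q s r = l1 * s\<^sup>2 + l2 * r\<^sup>2 + (l3 - l1 - l2) * (s * r)" for s r
  define a b m where "a = eval2 A (fst z) (snd z)" and "b = eval2 B (fst z) (snd z)"
    and "m = eval2 M (fst z) (snd z)"
  have "m \<noteq> 0" using M by (simp add: m_def)
  have at0: "coeff (?L A s r) 0 = a" "coeff (?L B s r) 0 = b" "coeff (?L M s r) 0 = m" for s r
    by (simp_all add: a_def b_def m_def flip: poly_0_coeff_0)
  \<comment> \<open>On the line z + t (s, r) the terms with \<open>f\<close> and \<open>g\<close>
    start at t^2 and the term with \<open>K\<close> at t^3, so the coefficients of 1 and t see only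
    \<open>M\<close> times the jet.\<close>
  have restr: "?L A s r * ?L f s r + ?L B s r * ?L g s r + [:0, s:] ^ 3 * ?L K s r
      + ?L M s r * [:c0, c1 * s + c2 * r, c3 * q s r:] = 0" for s r
  proof (rule poly_ext)
    fix t
    have "eval2 (A * f + B * g + local_x z ^ 3 * K
       + M * (smult [:c0:] 1 + smult [:c1:] (local_x z) + smult [:c2:] (local_y z)
         + smult [:c3:] (local_quadratic z l1 l2 l3))) (fst z + t * s) (snd z + t * r) = 0"
      unfolding eq by simp
    then show "poly (?L A s r * ?L f s r + ?L B s r * ?L g s r + [:0, s:] ^ 3 * ?L K s r
      + ?L M s r * [:c0, c1 * s + c2 * r, c3 * q s r:]) t = poly 0 t"
      by (simp add: local_x_def local_y_def local_quadratic_def q_def power2_eq_square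
          power3_eq_cube algebra_simps)
  qed
  have coeffs: "m * c0 = 0" "m * (c1 * s + c2 * r) + c0 * coeff (?L M s r) 1 = 0"
    "a * coeff (?L f s r) 2 + b * coeff (?L g s r) 2 + m * (c3 * q s r)
      + (c1 * s + c2 * r) * coeff (?L M s r) 1 + c0 * coeff (?L M s r) 2 = 0" for s r
  proof -
    obtain f1 where f1: "?L f s r = pCons 0 (pCons 0 f1)" using double_point_cofactor[OF f] .
    obtain g1 where g1: "?L g s r = pCons 0 (pCons 0 g1)" using double_point_cofactor[OF g] .
    have c: "coeff (?L A s r * ?L f s r + ?L B s r * ?L g s r + [:0, s:] ^ 3 * ?L K s r
      + ?L M s r * [:c0, c1 * s + c2 * r, c3 * q s r:]) i = 0" for i
      unfolding restr by simp
    show "m * c0 = 0"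
      using c[of 0] by (auto simp: f1 g1 at0 power3_eq_cube coeff_mult_0)
    show "m * (c1 * s + c2 * r) + c0 * coeff (?L M s r) 1 = 0"
      using c[of 1] by (simp add: f1 g1 at0 power3_eq_cube mult.commute)
    show "a * coeff (?L f s r) 2 + b * coeff (?L g s r) 2 + m * (c3 * q s r)
      + (c1 * s + c2 * r) * coeff (?L M s r) 1 + c0 * coeff (?L M s r) 2 = 0"
      using c[of 2] by (simp add: f1 g1 at0 power3_eq_cube coeff_mult_0 numeral_2_eq_2 mult.commute)
  qed
  have c0: "c0 = 0" using coeffs(1) \<open>m \<noteq> 0\<close> by simp
  have c1: "c1 = 0" and c2: "c2 = 0"
    using coeffs(2)[of 1 0] coeffs(2)[of 0 1] c0 \<open>m \<noteq> 0\<close> by auto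
  have sec: "a * coeff (?L f s r) 2 + b * coeff (?L g s r) 2 + m * c3 * q s r = 0" for s r
    using coeffs(3)[of s r] c0 c1 c2 by simp
  have q: "q 1 0 = l1" "q 0 1 = l2" "q 1 1 = l3"
    by (simp_all add: q_def)
  \<comment> \<open>Weighting the t^2-identities in the three directions by \<open>l1\<close>,
    \<open>l2\<close>, \<open>l3\<close> kills the parts of \<open>f\<close> and \<open>g\<close>.
    The jet's quadratic form takes just these values there, so a sum of squares remains; this is why
    it was chosen.\<close>
  have "l1 * (a * coeff (?L f 1 0) 2 + b * coeff (?L g 1 0) 2 + m * c3 * l1)
      + l2 * (a * coeff (?L f 0 1) 2 + b * coeff (?L g 0 1) 2 + m * c3 * l2)
      + l3 * (a * coeff (?L f 1 1) 2 + b * coeff (?L g 1 1) 2 + m * c3 * l3) = 0"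
    using sec[of 1 0] sec[of 0 1] sec[of 1 1] unfolding q by simp
  then have "a * (l1 * coeff (?L f 1 0) 2 + l2 * coeff (?L f 0 1) 2 + l3 * coeff (?L f 1 1) 2)
      + b * (l1 * coeff (?L g 1 0) 2 + l2 * coeff (?L g 0 1) 2 + l3 * coeff (?L g 1 1) 2)
      + m * c3 * (l1\<^sup>2 + l2\<^sup>2 + l3\<^sup>2) = 0"
    by (simp add: algebra_simps power2_eq_square)
  then have "m * c3 * (l1\<^sup>2 + l2\<^sup>2 + l3\<^sup>2) = 0"
    unfolding lf lg by simp
  moreover have "l1\<^sup>2 + l2\<^sup>2 + l3\<^sup>2 \<noteq> 0"
    using l by (auto simp: add_nonneg_eq_0_iff)
  ultimately show ?thesis
    using \<open>m \<noteq> 0\<close> c0 c1 c2 by simp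
qed

text \<open>Two equations in three unknowns. A binary quadratic form is determined by its values in
  the directions (1, 0), (0, 1), (1, 1), so \<open>l1\<close>, \<open>l2\<close>, \<open>l3\<close>
  describe a functional on quadratic parts.\<close>

lemma annihilator_of_quadratic_parts:
  obtains l1 l2 l3 where "(l1, l2, l3) \<noteq> (0, 0, 0)"
    and "l1 * coeff (line_restriction f z 1 0) 2 + l2 * coeff (line_restriction f z 0 1) 2
        + l3 * coeff (line_restriction f z 1 1) 2 = 0"
    and "l1 * coeff (line_restriction g z 1 0) 2 + l2 * coeff (line_restriction g z 0 1) 2
        + l3 * coeff (line_restriction g z 1 1) 2 = 0"
proof -
  define D :: "nat \<Rightarrow> real \<times> real" where "D = ((\<lambda>_. (1, 1))(0 := (1, 0), 1 := (0, 1)))"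
  define a where "a i b = coeff (line_restriction (if b then f else g) z (fst (D i)) (snd (D i))) 2" for i b
  have "\<exists>l. (\<exists>i\<in>{0, 1, 2}. l i \<noteq> 0) \<and> (\<forall>b\<in>UNIV. (\<Sum>i\<in>{0, 1, 2}. l i * a i b) = 0)"
    by (rule homogeneous_system_nontrivial) auto
  then obtain l where l: "\<exists>i\<in>{0, 1, 2}. l i \<noteq> 0"
    and l0: "\<And>b. (\<Sum>i\<in>{0, 1, 2}. l i * a i b) = 0" by blast
  show ?thesis
  proof (rule that[of "l 0" "l 1" "l 2"])
    show "(l 0, l 1, l 2) \<noteq> (0, 0, 0)" using l by auto
  qed (use l0[of True] l0[of False] in \<open>simp_all add: a_def D_def\<close>)
qed

section \<open>Counting monomials\<close>

lemma card_triangle_difference: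
  fixes d n :: nat
  assumes "d \<le> n"
  shows "card {(i, j). i + j \<le> n} = card {(i, j). i + j \<le> n - d} + card {(i, j). i + j \<le> n \<and> j < d}"
proof -
  let ?U = "{(i, j). i + j \<le> n \<and> d \<le> j}" and ?V = "{(i, j). i + j \<le> n \<and> j < d}"
  have fin: "finite ?U" "finite ?V"
    by (auto intro: finite_subset[OF _ finite_triangle[of n]])
  have "bij_betw (\<lambda>(i, j). (i, j + d)) {(i, j). i + j \<le> n - d} ?U"
    by (rule bij_betwI[where g = "\<lambda>(i, j). (i, j - d)"]) (use assms in auto)
  then have "card {(i, j). i + j \<le> n - d} = card ?U"
    by (rule bij_betw_same_card)
  moreover have "{(i, j). i + j \<le> n} = ?U \<union> ?V" by auto
  moreover have "card (?U \<union> ?V) = card ?U + card ?V"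
    by (rule card_Un_disjoint) (use fin in auto)
  ultimately show ?thesis by simp
qed

lemma card_strip:
  fixes d n :: nat
  assumes "d \<le> Suc n"
  shows "card {(i, j). i + j \<le> n \<and> j < d} = (\<Sum>j<d. Suc n - j)"
proof -
  have "bij_betw (\<lambda>(i, j). (j, i)) {(i, j). i + j \<le> n \<and> j < d} (Sigma {..<d} (\<lambda>j. {..<Suc n - j}))"
    by (rule bij_betwI[where g = "\<lambda>(i, j). (j, i)"]) auto
  then have "card {(i, j). i + j \<le> n \<and> j < d} = card (Sigma {..<d} (\<lambda>j. {..<Suc n - j}))"
    by (rule bij_betw_same_card)
  then show ?thesis by simp
qed

text \<open>Lowering \<open>n\<close> by \<open>d\<close> costs \<open>d\<close> monomials in each
  of the \<open>d\<close> rows; this is where the Bezout number \<open>d * d\<close> arises. The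
  hypothesis keeps the natural subtractions from being truncated.\<close>

lemma card_strip_difference:
  fixes d n :: nat
  assumes "2 * d \<le> Suc n"
  shows "card {(i, j). i + j \<le> n \<and> j < d} = card {(i, j). i + j \<le> n - d \<and> j < d} + d * d"
proof (cases "d = 0")
  case False
  have "(\<Sum>j<d. Suc n - j) = (\<Sum>j<d. (Suc (n - d) - j) + d)"
    by (intro sum.cong) (use assms False in auto)
  also have "\<dots> = (\<Sum>j<d. Suc (n - d) - j) + d * d"
    by (simp add: sum.distrib)
  finally show ?thesis using assms False by (simp add: card_strip)
qed simp

text \<open>If \<open>4 * card P\<close> exceeded \<open>d * d\<close>, then in large degree the multiples of \<open>f\<close>,
  the multiples of \<open>g\<close> reduced modulo \<open>f\<close> and the jets of order two at \<open>P\<close> would be linearly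
  dependent. A dependency involves no jets, so \<open>f\<close> and \<open>g\<close> would have a common factor.\<close>

theorem bezout_double_points:
  fixes f g :: "real poly poly"
  assumes f: "total_degree_le d f" "coeff f d \<noteq> 0" and g: "total_degree_le d g" and "coprime f g"
    and P: "finite P" "inj_on fst P"
    and dp: "\<And>z. z \<in> P \<Longrightarrow> double_point f z" "\<And>z. z \<in> P \<Longrightarrow> double_point g z"
  shows "4 * card P \<le> d * d"
proof (rule ccontr)
  assume "\<not> 4 * card P \<le> d * d"
  then have less: "d * d < 4 * card P" by simp
  \<comment> \<open>Large enough for the products of \<open>M z\<close>, of degree at most 3 (card P
    - 1), with jets of degree at most 2, and for the monomial count, which needs
    \<open>2 * d \<le> Suc N\<close>.\<close>
  define N where "N = 3 * card P + 2 * d"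
  have deg_f: "degree f = d"
    using f degree_le_total_degree le_degree le_antisym by blast
  have "\<forall>z. \<exists>l1 l2 l3. (l1, l2, l3) \<noteq> (0, 0, 0)
    \<and> l1 * coeff (line_restriction f z 1 0) 2 + l2 * coeff (line_restriction f z 0 1) 2
        + l3 * coeff (line_restriction f z 1 1) 2 = 0
    \<and> l1 * coeff (line_restriction g z 1 0) 2 + l2 * coeff (line_restriction g z 0 1) 2
        + l3 * coeff (line_restriction g z 1 1) 2 = 0"
    by (meson annihilator_of_quadratic_parts)
  then obtain l1 l2 l3 where l: "\<And>z. (l1 z, l2 z, l3 z) \<noteq> (0, 0, 0)"
    and lf: "\<And>z. l1 z * coeff (line_restriction f z 1 0) 2 + l2 z * coeff (line_restriction f z 0 1) 2
        + l3 z * coeff (line_restriction f z 1 1) 2 = 0"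
    and lg: "\<And>z. l1 z * coeff (line_restriction g z 1 0) 2 + l2 z * coeff (line_restriction g z 0 1) 2
        + l3 z * coeff (line_restriction g z 1 1) 2 = 0"
    by metis
  \<comment> \<open>\<open>M z\<close> contains the cube of \<open>local_x u\<close> for every other
    point \<open>u\<close>, so the terms of the other points are invisible to second order at
    \<open>z\<close>. It is nonzero at \<open>z\<close> because abscissae are distinct.\<close>
  define M where "M z = (\<Prod>u\<in>P - {z}. local_x u ^ 3)" for z
  define jet where "jet z k = (if k = 0 then 1 else if k = 1 then local_x z else if k = 2 then local_y z
      else local_quadratic z (l1 z) (l2 z) (l3 z))" for z and k :: nat
  define S1 where "S1 = {(i, j). i + j \<le> N - d}"
  \<comment> \<open>Multipliers of \<open>g\<close> have y-degree below \<open>d\<close>, the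
    y-degree of \<open>f\<close>. Hence a combination \<open>B\<close> of them that is divisible by
    \<open>f\<close> must be 0.\<close>
  define S2 where "S2 = {(i, j). i + j \<le> N - d \<and> j < d}"
  define S3 where "S3 = P \<times> {..<4::nat}"
  define mon :: "nat \<times> nat \<Rightarrow> real poly poly" where "mon = (\<lambda>(i, j). monom (monom 1 i) j)"
  define w where "w = case_sum (\<lambda>s. mon s * f) (case_sum (\<lambda>s. mon s * g) (\<lambda>s. M (fst s) * jet (fst s) (snd s)))"
  have fin: "finite S1" "finite S2" "finite S3"
    using P by (auto simp: S1_def S2_def S3_def intro: finite_subset[OF _ finite_triangle[of "N - d"]])
  have mon_deg: "total_degree_le (N - d) (mon s)" if "s \<in> S1 \<union> S2" for s
    using that by (auto simp: mon_def S1_def S2_def total_degree_le_def split: if_splits)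
  have x_deg: "total_degree_le 1 (local_x z)" and y_deg: "total_degree_le 1 (local_y z)" for z
    by (auto simp: local_x_def local_y_def total_degree_le_def coeff_pCons split: nat.splits)
  have one_deg: "total_degree_le 0 1"
    by (auto simp: total_degree_le_def coeff_1 split: if_splits)
  have q_deg: "total_degree_le 2 (local_quadratic z a b c)" for z a b c
    unfolding local_quadratic_def
    by (intro total_degree_le_add total_degree_le_smult)
       (use total_degree_le_power[OF x_deg, of 2] total_degree_le_power[OF y_deg, of 2]
          total_degree_le_mult[OF x_deg y_deg] in \<open>auto simp: numeral_2_eq_2\<close>)
  have jet_deg: "total_degree_le 2 (jet z k)" for z k
    using total_degree_le_mono[OF one_deg, of 2] total_degree_le_mono[OF x_deg, of 2]
      total_degree_le_mono[OF y_deg, of 2] q_deg by (simp add: jet_def)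
  have M_deg: "total_degree_le (3 * (card P - 1)) (M z)" if "z \<in> P" for z
    using total_degree_le_prod[of "P - {z}" 3 "\<lambda>u. local_x u ^ 3"] total_degree_le_power[OF x_deg, of 3] that P(1)
    by (simp add: M_def mult.commute)
  have w_deg: "total_degree_le N (w s)" if s: "s \<in> S1 <+> (S2 <+> S3)" for s
  proof -
    have "total_degree_le N (mon s * p)" if "s \<in> S1 \<union> S2" "total_degree_le d p" for s p
      using total_degree_le_mult[OF mon_deg[OF that(1)] that(2)] by (simp add: N_def add.commute)
    moreover have "total_degree_le N (M z * jet z k)" if "z \<in> P" for z k
    proof -
      have "card P > 0" using that P(1) card_gt_0_iff by blast
      then have "3 * (card P - 1) + 2 \<le> N" by (simp add: N_def)
      then show ?thesis
        using total_degree_le_mult[OF M_deg[OF that] jet_deg] total_degree_le_mono by blast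
    qed
    ultimately show ?thesis using s f g by (auto simp: w_def S3_def)
  qed
  have "card {(i, j). i + j \<le> N} < card (S1 <+> (S2 <+> S3))"
  proof -
    have "card {(i, j). i + j \<le> N} = card S1 + (card S2 + d * d)"
      using card_triangle_difference[of d N] card_strip_difference[of d N] by (simp add: N_def S1_def S2_def)
    also have "\<dots> < card S1 + (card S2 + card S3)"
      using less by (simp add: S3_def card_cartesian_product)
    finally show ?thesis using fin by (simp add: card_Plus)
  qed
  then obtain c where c: "\<exists>s\<in>S1 <+> (S2 <+> S3). c s \<noteq> 0"
    and c0: "(\<Sum>s\<in>S1 <+> (S2 <+> S3). smult [:c s:] (w s)) = 0"
    using poly2_family_dependent[of "S1 <+> (S2 <+> S3)" N w] fin w_deg by auto
  define A B where "A = (\<Sum>s\<in>S1. smult [:c (Inl s):] (mon s))"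
    and "B = (\<Sum>s\<in>S2. smult [:c (Inr (Inl s)):] (mon s))"
  define J where "J z = (\<Sum>k<4. smult [:c (Inr (Inr (z, k))):] (jet z k))" for z
  have rel: "A * f + B * g + (\<Sum>z\<in>P. M z * J z) = 0"
  proof -
    have "(\<Sum>s\<in>S3. smult [:c (Inr (Inr s)):] (M (fst s) * jet (fst s) (snd s))) = (\<Sum>z\<in>P. M z * J z)"
      unfolding S3_def J_def sum_distrib_left by (simp add: sum.cartesian_product case_prod_unfold)
    then show ?thesis
      using c0 fin by (simp add: sum.Plus w_def A_def B_def sum_distrib_right add.assoc)
  qed
  have jets: "c (Inr (Inr (z, k))) = 0" if z: "z \<in> P" and k: "k < 4" for z k
  proof -
    define c' where "c' k = c (Inr (Inr (z, k)))" for k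
    have "\<exists>K. (\<Sum>u\<in>P - {z}. M u * J u) = local_x z ^ 3 * K"
    proof -
      have "local_x z ^ 3 dvd M u * J u" if "u \<in> P - {z}" for u
      proof -
        have "local_x z ^ 3 dvd M u"
          unfolding M_def by (rule dvd_prodI) (use that z P(1) in auto)
        then show ?thesis by simp
      qed
      then have "local_x z ^ 3 dvd (\<Sum>u\<in>P - {z}. M u * J u)"
        by (rule dvd_sum)
      then show ?thesis by (auto elim: dvdE)
    qed
    then obtain K where K: "(\<Sum>u\<in>P - {z}. M u * J u) = local_x z ^ 3 * K" by blast
    have J: "J z = smult [:c' 0:] 1 + smult [:c' 1:] (local_x z) + smult [:c' 2:] (local_y z)
         + smult [:c' 3:] (local_quadratic z (l1 z) (l2 z) (l3 z))"
      by (simp add: J_def c'_def jet_def numeral_eq_Suc lessThan_Suc add_ac)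
    have "(\<Sum>u\<in>P. M u * J u) = M z * J z + local_x z ^ 3 * K"
      using P(1) z by (simp add: sum.remove[of P z] K)
    then have "A * f + B * g + local_x z ^ 3 * K + M z * (smult [:c' 0:] 1 + smult [:c' 1:] (local_x z)
         + smult [:c' 2:] (local_y z) + smult [:c' 3:] (local_quadratic z (l1 z) (l2 z) (l3 z))) = 0"
      using rel unfolding J[symmetric] by (simp only: ac_simps)
    moreover have "eval2 (M z) (fst z) (snd z) \<noteq> 0"
      using P z by (auto simp: M_def local_x_def inj_on_def)
    ultimately have "c' 0 = 0 \<and> c' 1 = 0 \<and> c' 2 = 0 \<and> c' 3 = 0"
      using dp[OF z] l lf lg by (intro jet_coefficients_vanish)
    moreover have "k = 0 \<or> k = 1 \<or> k = 2 \<or> k = 3" using k by auto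
    ultimately show ?thesis by (auto simp: c'_def)
  qed
  then have "J z = 0" if "z \<in> P" for z
    using that by (simp add: J_def)
  then have AB: "A * f + B * g = 0"
    using rel by simp
  have mon_coeff: "coeff (coeff (\<Sum>s\<in>S. smult [:a s:] (mon s)) j) i = (if (i, j) \<in> S then a (i, j) else 0)"
    if "finite S" for S i j and a :: "nat \<times> nat \<Rightarrow> real"
  proof -
    have "coeff (coeff (\<Sum>s\<in>S. smult [:a s:] (mon s)) j) i = (\<Sum>s\<in>S. if s = (i, j) then a s else 0)"
      unfolding coeff_sum by (intro sum.cong) (auto simp: mon_def split: if_splits)
    then show ?thesis using that by simp
  qed
  have "f dvd B * g"
    using AB by (metis add.commute add_eq_0_iff dvd_minus_iff dvd_triv_right)
  then have "f dvd B"
    using \<open>coprime f g\<close> by (simp add: coprime_dvd_mult_left_iff)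
  have "B = 0"
  proof (rule ccontr)
    assume "B \<noteq> 0"
    then have "d \<le> degree B"
      using \<open>f dvd B\<close> deg_f dvd_imp_degree_le by blast
    moreover have "coeff (coeff B (degree B)) i = (if i + degree B \<le> N - d \<and> degree B < d then c (Inr (Inl (i, degree B))) else 0)" for i
      unfolding B_def mon_coeff[OF fin(2), of "\<lambda>s. c (Inr (Inl s))"] by (simp add: S2_def)
    ultimately have "coeff B (degree B) = 0"
      by (intro poly_eqI) simp
    then show False using \<open>B \<noteq> 0\<close> by simp
  qed
  moreover have "f \<noteq> 0" using f(2) by auto
  ultimately have "A = 0" using AB by simp
  obtain s where s: "s \<in> S1 <+> (S2 <+> S3)" "c s \<noteq> 0" using c by blast
  then consider i j where "s = Inl (i, j)" "(i, j) \<in> S1" | i j where "s = Inr (Inl (i, j))" "(i, j) \<in> S2"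
    | z k where "s = Inr (Inr (z, k))" "z \<in> P" "k < 4"
    by (auto simp: S3_def)
  then show False
  proof cases
    case 1
    then show False
      using s mon_coeff[OF fin(1), of "\<lambda>s. c (Inl s)" j i] \<open>A = 0\<close> by (simp flip: A_def)
  next
    case 2
    then show False
      using s mon_coeff[OF fin(2), of "\<lambda>s. c (Inr (Inl s))" j i] \<open>B = 0\<close> by (simp flip: B_def)
  next
    case 3
    then show False using s jets by simp
  qed
qed

section \<open>Nonnegative sextics with ten zeros\<close>

lemma eval2_altdef: "eval2 p x y = (\<Sum>j\<le>degree p. poly (coeff p j) x * y ^ j)"
  by (simp add: eval2_def poly_altdef[of p] poly_sum)

text \<open>The complement of the zero set is connected, so values of both signs on it would force a
  zero there by the intermediate value property.\<close>

lemma finite_zeros2_semidefinite: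
  assumes "finite (zeros2 p)"
  shows "(\<forall>x y. 0 \<le> eval2 p x y) \<or> (\<forall>x y. eval2 p x y \<le> 0)"
proof (rule ccontr)
  assume "\<not> ?thesis"
  then obtain x y u v where xy: "eval2 p x y < 0" and uv: "eval2 p u v > 0"
    by (meson not_le)
  let ?F = "\<lambda>z. eval2 p (fst z) (snd z)"
  have "continuous_on (- zeros2 p) ?F"
    unfolding eval2_altdef by (intro continuous_intros)
  moreover have "connected (- zeros2 p)"
    using assms by (intro path_connected_imp_connected path_connected_complement_countable)
      (auto intro: countable_finite)
  ultimately have "connected (?F ` (- zeros2 p))"
    by (rule connected_continuous_image)
  moreover have "eval2 p x y \<in> ?F ` (- zeros2 p)" "eval2 p u v \<in> ?F ` (- zeros2 p)"
    using xy uv by (auto simp: zeros2_def intro: image_eqI[of _ _ "(x, y)"] image_eqI[of _ _ "(u, v)"])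
  ultimately have "0 \<in> ?F ` (- zeros2 p)"
    using xy uv connectedD_interval[of "?F ` (- zeros2 p)" "eval2 p x y" "eval2 p u v" 0] by simp
  then show False by (auto simp: zeros2_def)
qed

lemma zeros2_uminus [simp]: "zeros2 (- p) = zeros2 p"
  by (simp add: zeros2_def)

lemma zeros2_mult: "zeros2 (p * q) = zeros2 p \<union> zeros2 q"
  by (auto simp: zeros2_def)

lemma finite_zeros2_nonneg:
  assumes "finite (zeros2 p)"
  obtains q where "q = p \<or> q = - p" and "\<And>x y. 0 \<le> eval2 q x y"
proof (cases "\<forall>x y. 0 \<le> eval2 p x y")
  case True
  then show ?thesis using that[of p] by simp
next
  case False
  then have "0 \<le> eval2 (- p) x y" for x y
    using finite_zeros2_semidefinite[OF assms] by auto
  with that[of "- p"] show ?thesis by simp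
qed

lemma card_finite_zeros2_conic:
  assumes "total_degree_le 2 p" and "finite (zeros2 p)"
  shows "card (zeros2 p) \<le> 1"
proof -
  obtain q where "q = p \<or> q = - p" "\<And>x y. 0 \<le> eval2 q x y"
    using finite_zeros2_nonneg[OF assms(2)] by blast
  then show ?thesis
    using card_zeros_nonneg_conic[of q] assms total_degree_le_uminus by auto
qed

lemma card_finite_zeros2_quartic:
  assumes "total_degree_le 4 p" and "finite (zeros2 p)"
  shows "card (zeros2 p) \<le> 4"
proof -
  obtain q where "q = p \<or> q = - p" "\<And>x y. 0 \<le> eval2 q x y"
    using finite_zeros2_nonneg[OF assms(2)] by blast
  then show ?thesis
    using card_zeros_nonneg_quartic[of q] assms total_degree_le_uminus by auto
qed

text \<open>By \<open>deg\<close> the top coefficient in y is a nonzero constant, so the restriction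
  to the line x = 0 keeps the full degree. If this were odd, the restriction would change
  sign.\<close>

lemma finite_zeros2_even_degree:
  assumes deg: "total_degree_le (degree p) p" and fin: "finite (zeros2 p)"
  shows "even (degree p)"
proof (rule ccontr)
  assume odd: "odd (degree p)"
  define q where "q = line_restriction p (0, 0) 0 1"
  define r where "r = (\<Sum>j\<le>degree p. monom (coeff (coeff p j) 0) j)"
  have "q = r"
  proof (rule poly_ext)
    show "poly q y = poly r y" for y
      by (simp add: q_def r_def eval2_altdef poly_sum poly_monom poly_0_coeff_0)
  qed
  have coeff_r: "coeff r j = (if j \<le> degree p then coeff (coeff p j) 0 else 0)" for j
    by (simp add: r_def coeff_sum)
  have "degree (coeff p (degree p)) = 0"
    using degree_coeff_total_degree_le(1)[OF deg, of "degree p"] by simp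
  moreover have "coeff p (degree p) \<noteq> 0"
    using odd by auto
  ultimately have "coeff (coeff p (degree p)) 0 \<noteq> 0"
    by (metis leading_coeff_0_iff)
  then have "degree r = degree p"
    by (intro antisym degree_le le_degree) (auto simp: coeff_r)
  then obtain x y where "poly q x < 0" "0 < poly q y"
    using odd_degree_poly_changes_sign[of q] odd \<open>q = r\<close> by auto
  then have "eval2 p 0 x < 0" "0 < eval2 p 0 y"
    by (simp_all add: q_def)
  then show False
    using finite_zeros2_semidefinite[OF fin] by (meson not_le)
qed

section \<open>Total degrees of factors\<close>

lemma coeff_line_restriction_origin:
  "coeff (line_restriction p (0, 0) 1 c) k =
     (\<Sum>j\<le>degree p. if j \<le> k then coeff (coeff p j) (k - j) * c ^ j else 0)"
proof -
  have "line_restriction p (0, 0) 1 c = (\<Sum>j\<le>degree p. monom (c ^ j) j * coeff p j)"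
    by (rule poly_ext) (simp add: eval2_altdef poly_sum poly_monom power_mult_distrib mult_ac)
  then show ?thesis
    by (auto simp: coeff_sum coeff_monom_mult not_less mult.commute[of "coeff (coeff p _) _"] intro!: sum.cong)
qed

lemma degree_line_restriction_origin:
  assumes "total_degree_le n p"
  shows "degree (line_restriction p (0, 0) 1 c) \<le> n"
proof (rule degree_le, intro allI impI)
  fix k assume "n < k"
  have "coeff (coeff p j) (k - j) = 0" if "j \<le> k" for j
  proof (rule ccontr)
    assume "coeff (coeff p j) (k - j) \<noteq> 0"
    then have "k - j + j \<le> n" using assms by (simp add: total_degree_le_def)
    then show False using that \<open>n < k\<close> by simp
  qed
  then show "coeff (line_restriction p (0, 0) 1 c) k = 0"
    unfolding coeff_line_restriction_origin by (intro sum.neutral) auto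
qed

text \<open>\<open>w\<close> is the exact total degree. The coefficient of t^w on the line of slope
  \<open>c\<close> is the leading form at (1, c), a nonzero polynomial in \<open>c\<close>;
  \<open>S\<close> collects its roots.\<close>

lemma line_restriction_generic_degree:
  assumes "p \<noteq> 0"
  obtains w S where "total_degree_le w p" and "degree p \<le> w" and "finite S"
    and "\<And>c. c \<notin> S \<Longrightarrow>
      line_restriction p (0, 0) 1 c \<noteq> 0 \<and> w \<le> degree (line_restriction p (0, 0) 1 c)"
proof -
  define w where "w = (LEAST n. total_degree_le n p)"
  have "\<exists>n. total_degree_le n p"
  proof
    have "coeff (coeff p j) i = 0" if "degree p < j \<or> (\<Sum>j\<le>degree p. degree (coeff p j)) < i" for i j
    proof (cases "degree p < j")
      case True
      then show ?thesis by (simp add: coeff_eq_0)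
    next
      case False
      then have "degree (coeff p j) \<le> (\<Sum>j\<le>degree p. degree (coeff p j))"
        by (intro member_le_sum) auto
      then show ?thesis using that False by (intro coeff_eq_0) linarith
    qed
    then show "total_degree_le ((\<Sum>j\<le>degree p. degree (coeff p j)) + degree p) p"
      unfolding total_degree_le_def by (meson add_mono not_le)
  qed
  then have w: "total_degree_le w p"
    unfolding w_def by (rule LeastI_ex)
  have deg: "degree p \<le> w" by (rule degree_le_total_degree[OF w])
  have "\<exists>i j. i + j = w \<and> coeff (coeff p j) i \<noteq> 0"
  proof (rule ccontr)
    assume none: "\<nexists>i j. i + j = w \<and> coeff (coeff p j) i \<noteq> 0"
    show False
    proof (cases w)
      case 0
      have "p = 0"
      proof (intro poly_eqI)
        show "coeff (coeff p j) i = coeff (coeff 0 j) i" for i j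
          using none w 0 by (force simp: total_degree_le_def)
      qed
      then show False using assms by simp
    next
      case (Suc n)
      have "total_degree_le n p"
        unfolding total_degree_le_def
      proof (intro allI impI)
        fix i j assume *: "coeff (coeff p j) i \<noteq> 0"
        then have "i + j \<le> w" "i + j \<noteq> w" using w none by (auto simp: total_degree_le_def)
        then show "i + j \<le> n" using Suc by simp
      qed
      then show False using not_less_Least[of n "\<lambda>n. total_degree_le n p"] Suc w_def by simp
    qed
  qed
  then obtain i j where ij: "i + j = w" "coeff (coeff p j) i \<noteq> 0" by blast
  define L where "L = (\<Sum>j\<le>degree p. monom (coeff (coeff p j) (w - j)) j)"
  have "j \<le> degree p" using ij(2) by (intro le_degree) auto
  then have "coeff L j = coeff (coeff p j) i"
    using ij by (simp add: L_def coeff_sum flip: ij(1))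
  then have "L \<noteq> 0" using ij by auto
  then have fin: "finite {c. poly L c = 0}" by (rule poly_roots_finite)
  have "poly L c = coeff (line_restriction p (0, 0) 1 c) w" for c
    unfolding coeff_line_restriction_origin L_def poly_sum poly_monom
    by (intro sum.cong) (use deg in auto)
  then have "line_restriction p (0, 0) 1 c \<noteq> 0 \<and> w \<le> degree (line_restriction p (0, 0) 1 c)"
    if "c \<notin> {c. poly L c = 0}" for c
    using that by (metis coeff_0 le_degree mem_Collect_eq)
  with w deg fin show ?thesis using that by blast
qed

text \<open>On a generic line through the origin the total degrees of the factors add up. Each is at
  least the y-degree of its factor, and by \<open>deg\<close> their sum is at most the sum of the
  y-degrees, so equality holds for both.\<close>

lemma total_degree_le_factors:
  assumes "p \<noteq> 0" "q \<noteq> 0" and deg: "total_degree_le (degree p + degree q) (p * q)"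
  shows "total_degree_le (degree p) p" "total_degree_le (degree q) q"
proof -
  obtain w S where p: "total_degree_le w p" "degree p \<le> w" "finite S"
      "\<And>c. c \<notin> S \<Longrightarrow> line_restriction p (0, 0) 1 c \<noteq> 0 \<and> w \<le> degree (line_restriction p (0, 0) 1 c)"
    using line_restriction_generic_degree[OF \<open>p \<noteq> 0\<close>] by metis
  obtain v T where q: "total_degree_le v q" "degree q \<le> v" "finite T"
      "\<And>c. c \<notin> T \<Longrightarrow> line_restriction q (0, 0) 1 c \<noteq> 0 \<and> v \<le> degree (line_restriction q (0, 0) 1 c)"
    using line_restriction_generic_degree[OF \<open>q \<noteq> 0\<close>] by metis
  obtain c where c: "c \<notin> S \<union> T"
    using p(3) q(3) ex_new_if_finite[of "S \<union> T"] infinite_UNIV_char_0 by blast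
  let ?p = "line_restriction p (0, 0) 1 c" and ?q = "line_restriction q (0, 0) 1 c"
  have "w + v \<le> degree (?p * ?q)"
    using p(4)[of c] q(4)[of c] c by (simp add: degree_mult_eq)
  also have "?p * ?q = line_restriction (p * q) (0, 0) 1 c"
    by (rule poly_ext) simp
  also have "degree \<dots> \<le> degree p + degree q"
    by (rule degree_line_restriction_origin[OF deg])
  finally have "w = degree p" "v = degree q" using p(2) q(2) by auto
  then show "total_degree_le (degree p) p" "total_degree_le (degree q) q"
    using p(1) q(1) by auto
qed

lemma total_degree_le_0E:
  assumes "total_degree_le 0 p"
  obtains c where "p = [:[:c:]:]"
proof -
  have "degree p = 0" using degree_le_total_degree[OF assms] by simp
  moreover have "degree (coeff p 0) = 0"
    using degree_coeff_total_degree_le(1)[OF assms, of 0] by simp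
  ultimately show ?thesis using that by (metis degree_0_id)
qed

lemma even_degree_cases:
  fixes m n :: nat
  assumes "even m" "m + n = 6" "0 < m" "0 < n"
  shows "m = 2 \<and> n = 4 \<or> m = 4 \<and> n = 2"
  using assms by presburger

lemma nonneg_reducible_sextic_card_zeros:
  assumes deg: "total_degree_le 6 (p * q)" "degree p + degree q = 6"
    and pos: "0 < degree p" "0 < degree q" and fin: "finite (zeros2 (p * q))"
  shows "card (zeros2 (p * q)) \<le> 5"
proof -
  have "p \<noteq> 0" "q \<noteq> 0" using pos by auto
  then have p: "total_degree_le (degree p) p" and q: "total_degree_le (degree q) q"
    using total_degree_le_factors deg by auto
  have fins: "finite (zeros2 p)" "finite (zeros2 q)"
    using fin by (simp_all add: zeros2_mult)
  have "even (degree p)" using finite_zeros2_even_degree p fins by blast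
  then consider "degree p = 2" "degree q = 4" | "degree p = 4" "degree q = 2"
    using deg(2) pos by (metis even_degree_cases)
  then have "card (zeros2 p) + card (zeros2 q) \<le> 5"
  proof cases
    case 1
    then show ?thesis
      using card_finite_zeros2_conic[of p] card_finite_zeros2_quartic[of q] p q fins by simp
  next
    case 2
    then show ?thesis
      using card_finite_zeros2_conic[of q] card_finite_zeros2_quartic[of p] p q fins by simp
  qed
  then show ?thesis
    using card_Un_le[of "zeros2 p" "zeros2 q"] by (simp add: zeros2_mult)
qed

theorem nonneg_sextic_ten_zeros_extremal:
  assumes f: "total_degree_le 6 f" "coeff f 6 \<noteq> 0" and g: "total_degree_le 6 g"
    and nonneg: "\<And>x y. 0 \<le> eval2 g x y" "\<And>x y. eval2 g x y \<le> eval2 f x y"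
    and zeros: "card (zeros2 f) = 10" "inj_on fst (zeros2 f)"
  obtains c where "g = smult [:c:] f"
proof -
  have fin: "finite (zeros2 f)" using zeros(1) card_ge_0_finite by force
  have "f \<noteq> 0" using f(2) by auto
  have deg_f: "degree f = 6"
    using f degree_le_total_degree le_degree le_antisym by blast
  define h where "h = gcd f g"
  have "h \<noteq> 0" using \<open>f \<noteq> 0\<close> by (simp add: h_def)
  obtain a b where b: "f = b * h" and a: "g = a * h" and "coprime b a"
    using gcd_coprime_exists[of f g] \<open>h \<noteq> 0\<close> unfolding h_def by blast
  have "b \<noteq> 0" using b \<open>f \<noteq> 0\<close> by auto
  have deg: "degree b + degree h = 6"
    using degree_mult_eq[OF \<open>b \<noteq> 0\<close> \<open>h \<noteq> 0\<close>] deg_f b by simp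
  have bh: "total_degree_le (degree b) b" "total_degree_le (degree h) h"
    using total_degree_le_factors[OF \<open>b \<noteq> 0\<close> \<open>h \<noteq> 0\<close>] f(1) deg b by simp_all
  consider "degree h = 0" | "degree b = 0" | "0 < degree b" "0 < degree h" by auto
  then show ?thesis
  proof cases
    case 1
    then obtain c where c: "h = [:[:c:]:]"
      using bh(2) total_degree_le_0E by metis
    then have "c \<noteq> 0" using \<open>h \<noteq> 0\<close> by auto
    then have "is_unit h" by (simp add: c is_unit_const_poly_iff dvd_field_iff)
    then have "coprime f g" unfolding h_def by (metis is_unit_gcd)
    then have "4 * card (zeros2 f) \<le> 6 * 6"
    proof (rule bezout_double_points[OF f g])
      fix z assume "z \<in> zeros2 f"
      then have "eval2 f (fst z) (snd z) = 0" by (auto simp: zeros2_def)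
      moreover from this have "eval2 g (fst z) (snd z) = 0"
        using nonneg[of "fst z" "snd z"] by simp
      moreover have "0 \<le> eval2 f x y" for x y
        using nonneg[of x y] by simp
      ultimately show "double_point f z" "double_point g z"
        using nonneg_zero_double_point nonneg by blast+
    qed (use fin zeros in auto)
    then show ?thesis using zeros by simp
  next
    case 2
    then obtain u where u: "b = [:[:u:]:]"
      using bh(1) total_degree_le_0E by metis
    then have "u \<noteq> 0" using \<open>b \<noteq> 0\<close> by auto
    \<comment> \<open>As \<open>b\<close> is constant, \<open>h\<close> has y-degree 6, which leaves
      y-degree 0 for a nonzero \<open>a\<close> in \<open>g = a * h\<close>; the degree of factors
      then makes its total degree 0 as well.\<close>
    have "\<exists>v. a = [:[:v:]:]"
    proof (cases "a = 0")
      case True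
      then show ?thesis by (intro exI[of _ 0]) simp
    next
      case False
      have "degree a + degree h \<le> 6"
        using degree_le_total_degree[OF g] degree_mult_eq[OF False \<open>h \<noteq> 0\<close>] by (simp add: a)
      then have "degree a = 0" "degree h = 6" using deg 2 by simp_all
      then have "total_degree_le 0 a"
        using total_degree_le_factors(1)[OF False \<open>h \<noteq> 0\<close>] g a by simp
      then show ?thesis using total_degree_le_0E by metis
    qed
    then obtain v where v: "a = [:[:v:]:]" by blast
    have "g = smult [:v / u:] f"
      using \<open>u \<noteq> 0\<close> by (simp add: a b u v)
    then show ?thesis by (rule that)
  next
    case 3
    then have "card (zeros2 f) \<le> 5"
      using nonneg_reducible_sextic_card_zeros[of b h] f(1) fin deg by (simp add: b)
    then show ?thesis using zeros by simp
  qed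
qed

section \<open>Affine charts for ternary forms\<close>

lemma ternary_form_scaleR:
  assumes "F \<in> ternary_forms d"
  shows "F (t *\<^sub>R a) = t ^ d * F a"
proof -
  obtain c where c: "\<And>a. F a = (\<Sum>(i, j, k) \<in> {(i, j, k). i + j + k = d}.
      c i j k * (a $ 1) ^ i * (a $ 2) ^ j * (a $ 3) ^ k)"
    using assms by (auto simp: ternary_forms_def)
  show ?thesis
    unfolding c sum_distrib_left
    by (intro sum.cong) (auto simp: power_mult_distrib power_add)
qed

lemma ternary_form_continuous:
  assumes "F \<in> ternary_forms d"
  shows "isCont F a"
proof -
  obtain c where c: "F = (\<lambda>a. \<Sum>(i, j, k) \<in> {(i, j, k). i + j + k = d}.
      c i j k * (a $ 1) ^ i * (a $ 2) ^ j * (a $ 3) ^ k)"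
    using assms by (auto simp: ternary_forms_def)
  show ?thesis
    unfolding c case_prod_unfold by (intro continuous_intros)
qed

lemma ternary_form_tendsto_line:
  assumes "F \<in> ternary_forms d"
  shows "((\<lambda>t. F (a + t *\<^sub>R n)) \<longlongrightarrow> F a) (at 0)"
  by (rule isCont_tendsto_compose[OF ternary_form_continuous[OF assms]]) (auto intro!: tendsto_eq_intros)

lemma ternary_form_dehomogenize:
  assumes "F \<in> ternary_forms d"
  obtains p where "total_degree_le d p" and "\<And>x y. eval2 p x y = F (x *\<^sub>R l + y *\<^sub>R v + n)"
proof -
  obtain c where c: "\<And>a. F a = (\<Sum>(i, j, k) \<in> {(i, j, k). i + j + k = d}.
      c i j k * (a $ 1) ^ i * (a $ 2) ^ j * (a $ 3) ^ k)"
    using assms by (auto simp: ternary_forms_def)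
  \<comment> \<open>\<open>L m\<close> is the m-th coordinate of the point x l + y v + n as a
    polynomial in x and y.\<close>
  define L :: "3 \<Rightarrow> real poly poly" where "L m = [:[:n $ m, l $ m:], [:v $ m:]:]" for m
  have L: "total_degree_le 1 (L m)" for m
    by (auto simp: L_def total_degree_le_def coeff_pCons split: nat.splits)
  define p where "p = (\<Sum>(i, j, k) \<in> {(i, j, k). i + j + k = d}.
      smult [:c i j k:] (L 1 ^ i * L 2 ^ j * L 3 ^ k))"
  have "total_degree_le (i + j + k) (L 1 ^ i * L 2 ^ j * L 3 ^ k)" for i j k
    by (intro total_degree_le_mult) (use total_degree_le_power[OF L] in auto)
  then have "total_degree_le d p"
    unfolding p_def by (intro total_degree_le_sum) (auto intro!: total_degree_le_smult)
  moreover have "eval2 p x y = F (x *\<^sub>R l + y *\<^sub>R v + n)" for x y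
    unfolding p_def c eval2_sum
    by (intro sum.cong) (auto simp: L_def algebra_simps)
  ultimately show ?thesis by (rule that)
qed

text \<open>The vector \<open>v\<close> represents the point at infinity of the y-axis. The
  homogenisation at (0 : 1 : t) is F(v + t n) for t \<noteq> 0; as t tends to 0 only the y^d-term
  survives on one side and \<open>F v\<close> is the limit on the other.\<close>

lemma dehomogenized_top_coefficient:
  assumes F: "F \<in> ternary_forms d" and p: "total_degree_le d p"
    and eval: "\<And>x y. eval2 p x y = F (x *\<^sub>R l + y *\<^sub>R v + n)" and "F v \<noteq> 0"
  shows "coeff p d \<noteq> 0"
proof
  assume top: "coeff p d = 0"
  define \<phi> where "\<phi> = homogenize d p 0 1 [:0, 1:]"
  have "coeff (coeff p j) i * (0 ^ i * 1 ^ j * 0 ^ (d - i - j)) = 0" if "j \<le> d" for i j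
  proof (cases "i = 0 \<and> j = d")
    case True
    then show ?thesis using top by simp
  next
    case False
    then have "i \<noteq> 0 \<or> d - i - j \<noteq> 0" using that by auto
    then show ?thesis by auto
  qed
  then have "poly \<phi> 0 = 0"
    unfolding \<phi>_def homogenize_def poly_sum by (intro sum.neutral ballI) simp
  have eq: "poly \<phi> t = F (v + t *\<^sub>R n)" if "t \<noteq> 0" for t
  proof -
    have "poly \<phi> t = t ^ d * F ((1 / t) *\<^sub>R v + n)"
      using poly_homogenize[OF p, of "[:0, 1:]" t 0 1] that by (simp add: \<phi>_def eval)
    also have "\<dots> = F (t *\<^sub>R ((1 / t) *\<^sub>R v + n))"
      by (simp only: ternary_form_scaleR[OF F])
    finally show ?thesis using that by (simp add: scaleR_add_right)
  qed
  have "((\<lambda>t. F (v + t *\<^sub>R n)) \<longlongrightarrow> F v) (at 0)"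
    by (rule ternary_form_tendsto_line[OF F])
  moreover have "((\<lambda>t. F (v + t *\<^sub>R n)) \<longlongrightarrow> poly \<phi> 0) (at 0)"
  proof (rule Lim_transform_eventually)
    show "(poly \<phi> \<longlongrightarrow> poly \<phi> 0) (at 0)"
      using poly_isCont isCont_def by blast
    show "eventually (\<lambda>t. poly \<phi> t = F (v + t *\<^sub>R n)) (at 0)"
      using eq by (simp add: eventually_at_filter)
  qed
  ultimately have "F v = poly \<phi> 0"
    by (rule tendsto_unique[rotated]) simp
  then show False using \<open>poly \<phi> 0 = 0\<close> \<open>F v \<noteq> 0\<close> by simp
qed

text \<open>A point of the plane orthogonal to \<open>n\<close> is a limit of points off the plane,
  moving along \<open>n\<close>, and forms are continuous.\<close>

lemma ternary_forms_eqI_chart: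
  assumes F: "F \<in> ternary_forms d" and G: "G \<in> ternary_forms d" and "n \<noteq> 0"
    and eq: "\<And>a. a \<bullet> n \<noteq> 0 \<Longrightarrow> G a = c * F a"
  shows "G a = c * F a"
proof (cases "a \<bullet> n = 0")
  case True
  have "((\<lambda>t. G (a + t *\<^sub>R n)) \<longlongrightarrow> c * F a) (at 0)"
  proof (rule Lim_transform_eventually)
    show "((\<lambda>t. c * F (a + t *\<^sub>R n)) \<longlongrightarrow> c * F a) (at 0)"
      by (intro tendsto_mult tendsto_const ternary_form_tendsto_line[OF F])
    show "eventually (\<lambda>t. c * F (a + t *\<^sub>R n) = G (a + t *\<^sub>R n)) (at 0)"
      using True \<open>n \<noteq> 0\<close> eq by (simp add: eventually_at_filter inner_add_left)
  qed
  with ternary_form_tendsto_line[OF G] show ?thesis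
    using tendsto_unique[OF at_neq_bot] by blast
qed (rule eq)

text \<open>The moment curve (1, t, t^2) meets each plane through the origin for finitely many t
  only.\<close>

lemma generic_vector:
  fixes C :: "(real ^ 3) set"
  assumes "finite C" "0 \<notin> C"
  obtains v where "\<And>c. c \<in> C \<Longrightarrow> v \<bullet> c \<noteq> 0"
proof -
  define P where "P c = [:c $ 1, c $ 2, c $ 3:]" for c :: "real ^ 3"
  have "finite {t. poly (P c) t = 0}" if "c \<in> C" for c
  proof (rule poly_roots_finite)
    show "P c \<noteq> 0"
    proof
      assume "P c = 0"
      then have "c = 0" by (simp add: P_def vec_eq_iff forall_3)
      then show False using that assms(2) by simp
    qed
  qed
  then have "finite (\<Union>c\<in>C. {t. poly (P c) t = 0})"
    using assms(1) by blast
  then obtain t where t: "t \<notin> (\<Union>c\<in>C. {t. poly (P c) t = 0})"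
    using ex_new_if_finite infinite_UNIV_char_0 by blast
  have "vector [1, t, t\<^sup>2] \<bullet> c = poly (P c) t" for c :: "real ^ 3"
    by (simp add: inner_vec_def sum_3 vector_3 P_def power2_eq_square algebra_simps)
  then have "vector [1, t, t\<^sup>2] \<bullet> c \<noteq> 0" if "c \<in> C" for c :: "real ^ 3"
    using t that by auto
  then show ?thesis by (rule that)
qed

lemma cross3_eq_0_imp_span_eq:
  fixes a b :: "real ^ 3"
  assumes "cross3 a b = 0" "a \<noteq> 0" "b \<noteq> 0"
  shows "span {a} = span {b}"
proof -
  obtain c where c: "b = c *\<^sub>R a"
    using assms by (auto simp: cross_eq_0 collinear_lemma)
  then have "c \<noteq> 0" using assms by auto
  then have "a \<in> span {b}"
    using c span_mul[OF span_base, of b "{b}" "1 / c"] by simp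
  moreover have "b \<in> span {a}"
    using c span_mul[OF span_base, of a "{a}" c] by simp
  ultimately show ?thesis
    by (simp add: span_eq)
qed

lemma orthogonal_expansion:
  fixes v n :: "real ^ 3"
  assumes "v \<bullet> n = 0" "v \<noteq> 0" "n \<noteq> 0" and l: "l = cross3 v n"
  shows "l \<noteq> 0"
    and "a = (a \<bullet> l / (l \<bullet> l)) *\<^sub>R l + (a \<bullet> v / (v \<bullet> v)) *\<^sub>R v + (a \<bullet> n / (n \<bullet> n)) *\<^sub>R n"
proof -
  have "(norm l)\<^sup>2 = (norm v)\<^sup>2 * (norm n)\<^sup>2"
    using assms by (simp add: l norm_cross)
  then show "l \<noteq> 0" using assms(2,3) by auto
  have orth: "l \<bullet> v = 0" "l \<bullet> n = 0"
    by (simp_all add: l dot_cross_self inner_commute)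
  define d where "d = a - ((a \<bullet> l / (l \<bullet> l)) *\<^sub>R l + (a \<bullet> v / (v \<bullet> v)) *\<^sub>R v + (a \<bullet> n / (n \<bullet> n)) *\<^sub>R n)"
  have "d \<bullet> l = 0" "d \<bullet> v = 0" "d \<bullet> n = 0"
    using assms(1-3) orth \<open>l \<noteq> 0\<close>
    by (simp_all add: d_def inner_diff_left inner_add_left inner_commute[of v l] inner_commute[of n l] inner_commute[of n v])
  \<comment> \<open>The Lagrange identity expands the product of \<open>d\<close> with
    \<open>cross3 v n\<close> into multiples of \<open>d \<bullet> n\<close> and
    \<open>d \<bullet> v\<close>. So \<open>d\<close> is both parallel and orthogonal to
    \<open>l\<close>, which is nonzero.\<close>
  then have "cross3 d l = 0"
    by (simp add: l Lagrange)
  then have "d = 0"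
    using norm_and_cross_eq_0[of d l] \<open>d \<bullet> l = 0\<close> \<open>l \<noteq> 0\<close> by blast
  then show "a = (a \<bullet> l / (l \<bullet> l)) *\<^sub>R l + (a \<bullet> v / (v \<bullet> v)) *\<^sub>R v + (a \<bullet> n / (n \<bullet> n)) *\<^sub>R n"
    by (simp add: d_def)
qed

text \<open>Projection from \<open>v\<close> separates the points of \<open>R\<close> if
  \<open>v\<close> lies on no plane spanned by two of them. To be orthogonal to \<open>v\<close>,
  the normal is sought as \<open>cross3 v m\<close>; the triple product turns its conditions into
  genericity of \<open>m\<close>.\<close>

lemma generic_projection_centre:
  fixes R :: "(real ^ 3) set"
  assumes "finite R" and R: "\<And>a. a \<in> R \<Longrightarrow> \<exists>b\<in>R. cross3 a b \<noteq> 0"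
  obtains v n where "v \<bullet> n = 0" "v \<bullet> v \<noteq> 0"
    and "\<And>a. a \<in> R \<Longrightarrow> a \<bullet> n \<noteq> 0" and "\<And>a. a \<in> R \<Longrightarrow> cross3 a v \<noteq> 0"
    and "\<And>a b. a \<in> R \<Longrightarrow> b \<in> R \<Longrightarrow> cross3 a b \<noteq> 0 \<Longrightarrow> v \<bullet> cross3 a b \<noteq> 0"
proof -
  \<comment> \<open>The extra vector \<open>axis 1 1\<close> ensures
    \<open>v \<noteq> 0\<close>.\<close>
  let ?C = "insert (axis 1 1) ({cross3 a b | a b. a \<in> R \<and> b \<in> R} - {0})"
  have "{cross3 a b | a b. a \<in> R \<and> b \<in> R} = (\<lambda>(a, b). cross3 a b) ` (R \<times> R)"
    by auto
  then have "finite ?C" using assms(1) by simp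
  moreover have "0 \<notin> ?C" by (simp add: axis_eq_0_iff eq_commute[of 0])
  ultimately obtain v where v: "\<And>c. c \<in> ?C \<Longrightarrow> v \<bullet> c \<noteq> 0"
    using generic_vector by blast
  have "v \<noteq> 0" using v[of "axis 1 1"] by auto
  have vab: "v \<bullet> cross3 a b \<noteq> 0" if "a \<in> R" "b \<in> R" "cross3 a b \<noteq> 0" for a b
    using v[of "cross3 a b"] that by blast
  have av: "cross3 a v \<noteq> 0" if "a \<in> R" for a
  proof
    assume "cross3 a v = 0"
    moreover obtain b where b: "b \<in> R" "cross3 a b \<noteq> 0" using R[OF \<open>a \<in> R\<close>] by blast
    moreover have "v \<bullet> cross3 a b = - (cross3 a v \<bullet> b)"
      by (simp add: cross3_simps)
    ultimately show False using vab[OF that b] by simp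
  qed
  obtain m where m: "\<And>c. c \<in> (\<lambda>a. cross3 a v) ` R \<Longrightarrow> m \<bullet> c \<noteq> 0"
  proof (rule generic_vector)
    show "finite ((\<lambda>a. cross3 a v) ` R)" using assms(1) by simp
    show "0 \<notin> (\<lambda>a. cross3 a v) ` R" using av by (auto dest: sym)
  qed blast
  show ?thesis
  proof (rule that[of v "cross3 v m"])
    show "v \<bullet> cross3 v m = 0" "v \<bullet> v \<noteq> 0"
      using \<open>v \<noteq> 0\<close> by (simp_all add: dot_cross_self)
    show "a \<bullet> cross3 v m \<noteq> 0" if "a \<in> R" for a
    proof -
      have "a \<bullet> cross3 v m = m \<bullet> cross3 a v"
        by (simp add: cross3_simps)
      then show ?thesis using m that by simp
    qed
  qed (use av vab in auto)
qed

text \<open>Chart points with equal x differ by a multiple of \<open>v\<close>, so two zeros among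
  them would span a plane containing \<open>v\<close>, which genericity excludes. The hypothesis
  \<open>two\<close> gives each zero line a different partner; the plane through both avoids
  \<open>v\<close>, hence so does the line, and \<open>F v \<noteq> 0\<close>.\<close>

lemma ternary_form_generic_chart:
  fixes F :: "real ^ 3 \<Rightarrow> real"
  assumes F: "F \<in> ternary_forms d" and fin: "finite (zero_lines F)" and two: "2 \<le> card (zero_lines F)"
  obtains l v n :: "real ^ 3" and Z where "n \<noteq> 0" and "F v \<noteq> 0"
    and "\<And>a. a \<bullet> n \<noteq> 0 \<Longrightarrow> \<exists>t x y. a = t *\<^sub>R (x *\<^sub>R l + y *\<^sub>R v + n)"
    and "Z = {(x, y). F (x *\<^sub>R l + y *\<^sub>R v + n) = 0}"
    and "card Z = card (zero_lines F)" and "inj_on fst Z"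
proof -
  have "zero_lines F = (\<lambda>a. span {a}) ` zeros F"
    by (auto simp: zero_lines_def)
  then obtain R where R: "R \<subseteq> zeros F" "inj_on (\<lambda>a. span {a}) R" "zero_lines F = (\<lambda>a. span {a}) ` R"
    using subset_image_inj[of "zero_lines F" "\<lambda>a. span {a}" "zeros F"] by auto
  have "finite R" "card R = card (zero_lines F)"
    using R fin by (auto simp: card_image dest: finite_imageD)
  have cross_R: "cross3 a b \<noteq> 0" if "a \<in> R" "b \<in> R" "a \<noteq> b" for a b
    using cross3_eq_0_imp_span_eq[of a b] that R by (auto simp: zeros_def dest: inj_onD)
  have ex_cross: "\<exists>b\<in>R. cross3 a b \<noteq> 0" if "a \<in> R" for a
  proof -
    have "\<not> R \<subseteq> {a}"
      using two \<open>card R = card (zero_lines F)\<close> card_mono[of "{a}" R] by auto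
    then show ?thesis using cross_R[OF that] by blast
  qed
  obtain v n where vn: "v \<bullet> n = 0" "v \<bullet> v \<noteq> 0" and Rn: "\<And>a. a \<in> R \<Longrightarrow> a \<bullet> n \<noteq> 0"
    and Rv: "\<And>a. a \<in> R \<Longrightarrow> cross3 a v \<noteq> 0"
    and Rab: "\<And>a b. a \<in> R \<Longrightarrow> b \<in> R \<Longrightarrow> cross3 a b \<noteq> 0 \<Longrightarrow> v \<bullet> cross3 a b \<noteq> 0"
    by (rule generic_projection_centre[OF \<open>finite R\<close> ex_cross]) (assumption | rule that)+
  have "R \<noteq> {}" using two \<open>card R = card (zero_lines F)\<close> by auto
  then have "n \<noteq> 0" using Rn by force
  have "v \<noteq> 0" using vn by auto
  define l where "l = cross3 v n"
  note expand = orthogonal_expansion[OF vn(1) \<open>v \<noteq> 0\<close> \<open>n \<noteq> 0\<close> l_def]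
  have orth: "l \<bullet> v = 0" "l \<bullet> n = 0"
    by (simp_all add: l_def dot_cross_self inner_commute)
  define P where "P x y = x *\<^sub>R l + y *\<^sub>R v + n" for x y
  define Z where "Z = {(x, y). F (P x y) = 0}"
  have Pn: "P x y \<bullet> n = n \<bullet> n" and Pl: "P x y \<bullet> l = x * (l \<bullet> l)" and Pv: "P x y \<bullet> v = y * (v \<bullet> v)" for x y
    using orth vn(1) by (simp_all add: P_def inner_add_left inner_commute[of v l] inner_commute[of n l] inner_commute[of n v])
  have P_nz: "P x y \<noteq> 0" for x y
    using Pn[of x y] \<open>n \<noteq> 0\<close> by auto
  have chart: "\<exists>x y. a = (a \<bullet> n / (n \<bullet> n)) *\<^sub>R P x y" if "a \<bullet> n \<noteq> 0" for a
  proof -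
    define z where "z = a \<bullet> n / (n \<bullet> n)"
    have "z \<noteq> 0" using that \<open>n \<noteq> 0\<close> by (simp add: z_def)
    have "a = (a \<bullet> l / (l \<bullet> l)) *\<^sub>R l + (a \<bullet> v / (v \<bullet> v)) *\<^sub>R v + z *\<^sub>R n"
      unfolding z_def by (rule expand(2))
    then have "a = z *\<^sub>R P (a \<bullet> l / (l \<bullet> l) / z) (a \<bullet> v / (v \<bullet> v) / z)"
      using \<open>z \<noteq> 0\<close> by (simp add: P_def scaleR_add_right)
    then show ?thesis unfolding z_def by blast
  qed
  have "F v \<noteq> 0"
  proof
    assume "F v = 0"
    then have "span {v} \<in> zero_lines F"
      using \<open>v \<noteq> 0\<close> by (auto simp: zero_lines_def zeros_def)
    then obtain a where a: "a \<in> R" "span {v} = span {a}" using R by auto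
    then have "a \<in> span {v}" by (simp add: span_base)
    then obtain k where "a = k *\<^sub>R v" by (auto simp: span_singleton)
    then show False using Rv[OF a(1)] by (simp add: cross_mult_left)
  qed
  have rep: "\<exists>a\<in>R. \<exists>k. P x y = k *\<^sub>R a" if "(x, y) \<in> Z" for x y
  proof -
    have "span {P x y} \<in> zero_lines F"
      using that P_nz by (auto simp: zero_lines_def zeros_def Z_def)
    then obtain a where "a \<in> R" "span {P x y} = span {a}" using R by auto
    then have "P x y \<in> span {a}" by (metis insertI1 span_base)
    with \<open>a \<in> R\<close> show ?thesis by (auto simp: span_singleton)
  qed
  have inj: "x = x' \<and> y = y'" if "P x y = k *\<^sub>R P x' y'" for x y x' y' k
  proof -
    have "n \<bullet> n = k * (n \<bullet> n)" using that Pn[of x y] Pn[of x' y'] by simp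
    then have "P x y = P x' y'" using that \<open>n \<noteq> 0\<close> by simp
    then have "x * (l \<bullet> l) = x' * (l \<bullet> l)" "y * (v \<bullet> v) = y' * (v \<bullet> v)"
      by (metis Pl, metis Pv)
    then show ?thesis using expand(1) vn(2) by simp
  qed
  have "bij_betw (\<lambda>(x, y). span {P x y}) Z (zero_lines F)"
    unfolding bij_betw_def
  proof
    show "inj_on (\<lambda>(x, y). span {P x y}) Z"
    proof (rule inj_onI, clarify)
      fix x y x' y' assume "span {P x y} = span {P x' y'}"
      then have "P x y \<in> span {P x' y'}" by (metis insertI1 span_base)
      then show "x = x' \<and> y = y'" using inj by (auto simp: span_singleton)
    qed
    show "(\<lambda>(x, y). span {P x y}) ` Z = zero_lines F"
    proof
      show "(\<lambda>(x, y). span {P x y}) ` Z \<subseteq> zero_lines F"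
        using P_nz by (auto simp: zero_lines_def zeros_def Z_def)
      show "zero_lines F \<subseteq> (\<lambda>(x, y). span {P x y}) ` Z"
      proof
        fix L assume "L \<in> zero_lines F"
        then obtain a where a: "a \<in> R" "L = span {a}" using R by auto
        define z where "z = a \<bullet> n / (n \<bullet> n)"
        have "z \<noteq> 0" using Rn[OF a(1)] \<open>n \<noteq> 0\<close> by (simp add: z_def)
        obtain x y where xy: "a = z *\<^sub>R P x y"
          using chart[OF Rn[OF a(1)]] unfolding z_def by blast
        have "F a = 0" using a(1) R(1) by (auto simp: zeros_def)
        then have "(x, y) \<in> Z"
          using ternary_form_scaleR[OF F, of z "P x y"] \<open>z \<noteq> 0\<close> by (simp add: Z_def xy)
        moreover have "L = span {P x y}"
        proof -
          have "a \<in> span {P x y}" unfolding xy by (simp add: span_base span_mul)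
          moreover have "P x y = (1 / z) *\<^sub>R a" using xy \<open>z \<noteq> 0\<close> by simp
          then have "P x y \<in> span {a}" by (metis insertI1 span_base span_mul)
          ultimately show ?thesis unfolding a(2) by (simp add: span_eq)
        qed
        ultimately show "L \<in> (\<lambda>(x, y). span {P x y}) ` Z" by force
      qed
    qed
  qed
  then have "card Z = card (zero_lines F)" by (rule bij_betw_same_card)
  moreover have "inj_on fst Z"
  proof (rule inj_onI, clarsimp)
    fix x y y' assume xy: "(x, y) \<in> Z" "(x, y') \<in> Z"
    show "y = y'"
    proof (rule ccontr)
      assume "y \<noteq> y'"
      obtain a k where a: "a \<in> R" "P x y = k *\<^sub>R a" using rep[OF xy(1)] by blast
      obtain b k' where b: "b \<in> R" "P x y' = k' *\<^sub>R b" using rep[OF xy(2)] by blast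
      have k: "k \<noteq> 0" "k' \<noteq> 0" using a b P_nz by force+
      have "a \<noteq> b"
      proof
        assume "a = b"
        then have "P x y = (k / k') *\<^sub>R P x y'" using a b k by simp
        then show False using inj \<open>y \<noteq> y'\<close> by blast
      qed
      then have "v \<bullet> cross3 a b \<noteq> 0"
        using Rab a b cross_R by blast
      moreover have "(y - y') *\<^sub>R v = P x y - P x y'"
        by (simp add: P_def algebra_simps)
      then have "((y - y') *\<^sub>R v) \<bullet> cross3 (P x y) (P x y') = 0"
        by (simp add: inner_diff_left dot_cross_self)
      then have "(y - y') * (k * k') * (v \<bullet> cross3 a b) = 0"
        by (auto simp: a b cross_mult_left cross_mult_right)
      ultimately show False using k \<open>y \<noteq> y'\<close> by simp
    qed
  qed
  ultimately show ?thesis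
    using that[of n v l Z] \<open>n \<noteq> 0\<close> \<open>F v \<noteq> 0\<close> chart unfolding Z_def P_def by blast
qed

lemma psd_sextic_dominated_by_ten_zeros:
  assumes F: "F \<in> P36" and card: "card (zero_lines F) = 10"
    and G: "G \<in> P36" and le: "\<And>a. G a \<le> F a"
  shows "\<exists>l\<ge>0. \<forall>a. G a = l * F a"
proof -
  have F6: "F \<in> ternary_forms 6" "\<And>a. 0 \<le> F a" and G6: "G \<in> ternary_forms 6" "\<And>a. 0 \<le> G a"
    using F G by (auto simp: P36_def)
  \<comment> \<open>Infinite sets have \<open>card\<close> 0, so cardinality 10 includes
    finiteness.\<close>
  have fin: "finite (zero_lines F)" and two: "2 \<le> card (zero_lines F)"
    using card card_ge_0_finite by force+
  obtain l v n :: "real ^ 3" and Z where "n \<noteq> 0" "F v \<noteq> 0"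
    and chart: "\<And>a. a \<bullet> n \<noteq> 0 \<Longrightarrow> \<exists>t x y. a = t *\<^sub>R (x *\<^sub>R l + y *\<^sub>R v + n)"
    and Z: "Z = {(x, y). F (x *\<^sub>R l + y *\<^sub>R v + n) = 0}" "card Z = card (zero_lines F)" "inj_on fst Z"
    by (rule ternary_form_generic_chart[OF F6(1) fin two]) (assumption | rule that)+
  obtain f where f: "total_degree_le 6 f" "\<And>x y. eval2 f x y = F (x *\<^sub>R l + y *\<^sub>R v + n)"
    using ternary_form_dehomogenize[OF F6(1)] by blast
  obtain g where g: "total_degree_le 6 g" "\<And>x y. eval2 g x y = G (x *\<^sub>R l + y *\<^sub>R v + n)"
    using ternary_form_dehomogenize[OF G6(1)] by blast
  have "zeros2 f = Z" by (simp add: zeros2_def f(2) Z(1))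
  moreover have "coeff f 6 \<noteq> 0"
    by (rule dehomogenized_top_coefficient[OF F6(1) f]) fact
  ultimately obtain c where c: "g = smult [:c:] f"
    using nonneg_sextic_ten_zeros_extremal[OF f(1) _ g(1)] f(2) g(2) G6(2) le Z card by metis
  have GF: "G a = c * F a" for a
  proof (rule ternary_forms_eqI_chart[OF F6(1) G6(1) \<open>n \<noteq> 0\<close>])
    fix a assume "a \<bullet> n \<noteq> 0"
    then obtain t x y where a: "a = t *\<^sub>R (x *\<^sub>R l + y *\<^sub>R v + n)" using chart by blast
    have "G (x *\<^sub>R l + y *\<^sub>R v + n) = c * F (x *\<^sub>R l + y *\<^sub>R v + n)"
      using f(2)[of x y] g(2)[of x y] by (simp add: c)
    then show "G a = c * F a"
      by (simp add: a ternary_form_scaleR[OF F6(1)] ternary_form_scaleR[OF G6(1)])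
  qed
  \<comment> \<open>\<open>F v\<close> is positive, so \<open>v\<close> is a point at which the sign
    of \<open>c\<close> can be read off.\<close>
  have "0 \<le> c * F v" using G6(2)[of v] by (simp add: GF)
  then have "0 \<le> c" using F6(2)[of v] \<open>F v \<noteq> 0\<close> by (simp add: zero_le_mult_iff)
  then show ?thesis using GF by blast
qed

theorem theorem7p2:
  fixes F :: "real ^ 3 \<Rightarrow> real"
  assumes "F \<in> P36"
    and "card (zero_lines F) = 10"
  shows "F \<in> extremal_P36"
  unfolding extremal_P36_def
proof (intro CollectI conjI ballI impI)
  fix G1 G2 assume G: "G1 \<in> P36" "G2 \<in> P36" and sum: "\<forall>a. F a = G1 a + G2 a"
  have le: "G1 a \<le> F a" "G2 a \<le> F a" for a
    using G sum by (simp_all add: P36_def)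
  show "\<exists>l1\<ge>0. \<forall>a. G1 a = l1 * F a" "\<exists>l2\<ge>0. \<forall>a. G2 a = l2 * F a"
    using psd_sextic_dominated_by_ten_zeros[OF assms] G le by blast+
qed (rule assms(1))

end
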